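(* Let $f_1,f_2,u_1,u_2$ be real constants with $f_1>0$, $f_1+f_2>0$ and $u_2<0$. Let $(f_{FP},u_{FP})$ be the generalized FP-solution of the Riemann problem for the one-dimensional pressureless gas dynamics system $\partial_tf+\partial_x(fu)=0$, $\partial_t(fu)+\partial_x(fu^2)=0$ with the constant left-hand and right-hand initial states $$f_0(x)=f_1+f_2\,\theta(x),\qquad u_0(x)=u_1+u_2\,\theta(x).$$ Then $(f_{FP},u_{FP})$ solves in fact, in the sense of integral identities, the gas dynamics system with pressure $$\partial_tf+\partial_x(fu)=0,\qquad \partial_t(fu)+\partial_x(fu^2+p)=0,\qquad t>0,\ x\in\mathbb{R},$$ where $$p(t,x)=\frac{f_1(f_1+f_2)\,u_2^2}{2f_1+f_2}\,\Big(\theta(x-(u_1+u_2)t)-\theta(x-u_1t)\Big).$$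
   Context: $\theta$ is the Heaviside function. "In the sense of integral identities" means in the sense of distributions (weak solution). FP-generalized solution (generalized solution in the sense of free particles) in one space dimension for initial data $(f_0,u_0)\in L^2_{loc}(\mathbb{R})\cap L_\infty(\mathbb{R})$: the couple $(f_{FP},u_{FP})$ such that for almost all $(t,x)\in\mathbb{R}_+\times\mathbb{R}$ $$f_{FP}(t,x)=\lim_{\varepsilon\to0}\Big(\lim_{\sigma\to0}\rho^\varepsilon_\sigma(t,x)\Big),\qquad u_{FP}(t,x)=\lim_{\varepsilon\to0}\Big(\lim_{\sigma\to0}\hat u^\varepsilon_\sigma(t,x)\Big),$$ where $$\rho^\varepsilon_\sigma(t,x)=\frac{1}{\sqrt{2\pi t}\,\sigma}\int_{\mathbb{R}}f_0^\varepsilon(s)\,e^{-\frac{(u_0^\varepsilon(s)t+s-x)^2}{2\sigma^2t}}\,ds,\qquad \hat u^\varepsilon_\sigma(t,x)=\frac{\int_{\mathbb{R}}u_0^\varepsilon(s)f_0^\varepsilon(s)\,e^{-\frac{(u_0^\varepsilon(s)t+s-x)^2}{2\sigma^2t}}\,ds}{\int_{\mathbb{R}}f_0^\varepsilon(s)\,e^{-\frac{(u_0^\varepsilon(s)t+s-x)^2}{2\sigma^2t}}\,ds},$$ and $f_0^\varepsilon=\eta_\varepsilon*f_0$, $u_0^\varepsilon=\eta_\varepsilon*u_0$ with $\eta_\varepsilon$ the standard averaging (mollifying) kernel. (For the Riemann data the paper computes these limits using instead the piecewise linear approximation of $f_0,u_0$ that interpolates linearly between the two constant states on $[-\varepsilon,\varepsilon]$.)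 *)

theory Defs
  imports "HOL-Analysis.Analysis"
begin

definition heaviside :: "real \<Rightarrow> real" where
  "heaviside x = (if 0 \<le> x then 1 else 0)"

(* Besides all smooth mollifiers supported in [-1,1], in particular the standard bump
   c * exp (-1 / (1 - x^2)), this class contains the box kernel 1/2 on [-1,1]. The average of a
   two-state step function with the box kernel is its linear interpolation on [-\<epsilon>,\<epsilon>]. *)
definition averaging_kernel :: "(real \<Rightarrow> real) \<Rightarrow> bool" where
  "averaging_kernel \<eta> \<longleftrightarrow>
     (\<forall>x. 0 \<le> \<eta> x) \<and> (\<forall>x. 1 < \<bar>x\<bar> \<longrightarrow> \<eta> x = 0) \<and> continuous_on {-1<..<1} \<eta> \<and>
     integrable lebesgue \<eta> \<and> (LINT x|lebesgue. \<eta> x) = 1"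

definition averaged :: "(real \<Rightarrow> real) \<Rightarrow> real \<Rightarrow> (real \<Rightarrow> real) \<Rightarrow> real \<Rightarrow> real" where
  "averaged \<eta> \<epsilon> g x = (LINT y|lebesgue. \<eta> ((x - y) / \<epsilon>) / \<epsilon> * g y)"

definition particle_weight :: "(real \<Rightarrow> real) \<Rightarrow> real \<Rightarrow> real \<Rightarrow> real \<Rightarrow> real \<Rightarrow> real" where
  "particle_weight u0 \<sigma> t x s = exp (- ((u0 s * t + s - x)\<^sup>2 / (2 * \<sigma>\<^sup>2 * t)))"

definition fp_density ::
  "(real \<Rightarrow> real) \<Rightarrow> (real \<Rightarrow> real) \<Rightarrow> real \<Rightarrow> real \<Rightarrow> real \<Rightarrow> real" where
  "fp_density f0 u0 \<sigma> t x =
     1 / (sqrt (2 * pi * t) * \<sigma>) * (LINT s|lebesgue. f0 s * particle_weight u0 \<sigma> t x s)"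

definition fp_velocity ::
  "(real \<Rightarrow> real) \<Rightarrow> (real \<Rightarrow> real) \<Rightarrow> real \<Rightarrow> real \<Rightarrow> real \<Rightarrow> real" where
  "fp_velocity f0 u0 \<sigma> t x =
     (LINT s|lebesgue. u0 s * f0 s * particle_weight u0 \<sigma> t x s) /
     (LINT s|lebesgue. f0 s * particle_weight u0 \<sigma> t x s)"

(* l = lim (\<epsilon> -> 0+) (lim (\<sigma> -> 0+) F \<epsilon> \<sigma>); the inner limit has to exist for all small \<epsilon> *)
definition has_iterated_limit :: "(real \<Rightarrow> real \<Rightarrow> real) \<Rightarrow> real \<Rightarrow> bool" where
  "has_iterated_limit F l \<longleftrightarrow>
     (\<exists>G. (\<forall>\<^sub>F \<epsilon> in at_right 0. (F \<epsilon> \<longlongrightarrow> G \<epsilon>) (at_right 0)) \<and> (G \<longlongrightarrow> l) (at_right 0))"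

definition FP_solution ::
  "(real \<Rightarrow> real) \<Rightarrow> (real \<Rightarrow> real) \<Rightarrow> (real \<Rightarrow> real) \<Rightarrow>
   (real \<times> real \<Rightarrow> real) \<Rightarrow> (real \<times> real \<Rightarrow> real) \<Rightarrow> bool" where
  "FP_solution \<eta> f0 u0 f u \<longleftrightarrow>
     (AE (t, x) in lebesgue. 0 < t \<longrightarrow>
        has_iterated_limit
          (\<lambda>\<epsilon> \<sigma>. fp_density (averaged \<eta> \<epsilon> f0) (averaged \<eta> \<epsilon> u0) \<sigma> t x) (f (t, x)) \<and>
        has_iterated_limit
          (\<lambda>\<epsilon> \<sigma>. fp_velocity (averaged \<eta> \<epsilon> f0) (averaged \<eta> \<epsilon> u0) \<sigma> t x) (u (t, x)))"

definition partial_t :: "(real \<times> real \<Rightarrow> real) \<Rightarrow> real \<times> real \<Rightarrow> real" where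
  "partial_t \<phi> z = frechet_derivative \<phi> (at z) (1, 0)"

definition partial_x :: "(real \<times> real \<Rightarrow> real) \<Rightarrow> real \<times> real \<Rightarrow> real" where
  "partial_x \<phi> z = frechet_derivative \<phi> (at z) (0, 1)"

primrec C_k :: "nat \<Rightarrow> (real \<times> real \<Rightarrow> real) \<Rightarrow> bool" where
  "C_k 0 \<phi> \<longleftrightarrow> continuous_on UNIV \<phi>"
| "C_k (Suc k) \<phi> \<longleftrightarrow> (\<forall>z. \<phi> differentiable (at z)) \<and> C_k k (partial_t \<phi>) \<and> C_k k (partial_x \<phi>)"

definition half_plane :: "(real \<times> real) set" where
  "half_plane = {0<..} \<times> UNIV"

definition test_function :: "(real \<times> real \<Rightarrow> real) \<Rightarrow> bool" where
  "test_function \<phi> \<longleftrightarrow>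
     (\<forall>k. C_k k \<phi>) \<and> (\<exists>K. compact K \<and> K \<subseteq> half_plane \<and> (\<forall>z. z \<notin> K \<longrightarrow> \<phi> z = 0))"

definition locally_integrable :: "(real \<times> real \<Rightarrow> real) \<Rightarrow> bool" where
  "locally_integrable g \<longleftrightarrow>
     (\<forall>K. compact K \<and> K \<subseteq> half_plane \<longrightarrow> set_integrable lebesgue K g)"

(* the conservation law g_t + h_x = 0 in the distributions on the open half-plane t > 0 *)
definition weak_conservation_law ::
  "(real \<times> real \<Rightarrow> real) \<Rightarrow> (real \<times> real \<Rightarrow> real) \<Rightarrow> bool" where
  "weak_conservation_law g h \<longleftrightarrow>
     locally_integrable g \<and> locally_integrable h \<and>
     (\<forall>\<phi>. test_function \<phi> \<longrightarrow>
        (LINT z:half_plane|lebesgue. g z * partial_t \<phi> z + h z * partial_x \<phi> z) = 0)"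

definition weak_gas_dynamics ::
  "(real \<times> real \<Rightarrow> real) \<Rightarrow> (real \<times> real \<Rightarrow> real) \<Rightarrow> (real \<times> real \<Rightarrow> real) \<Rightarrow> bool" where
  "weak_gas_dynamics f u p \<longleftrightarrow>
     weak_conservation_law f (\<lambda>z. f z * u z) \<and>
     weak_conservation_law (\<lambda>z. f z * u z) (\<lambda>z. f z * (u z)\<^sup>2 + p z)"

end

theory Submission
  imports Defs "HOL-Probability.Distributions"
begin

text \<open>
  The particles of the smoothed data move freely: the one that starts at \<open>s\<close> is at time \<open>t\<close> at
  \<open>s + t u0(s)\<close>, up to a Gaussian error of variance \<open>\<sigma>\<^sup>2 t\<close>. For \<open>\<sigma> \<rightarrow> 0\<close> the density at
  \<open>(t, x)\<close> becomes the sum of \<open>f0 / \<bar>1 + t u0'\<bar>\<close> over the starting points of the particles that are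
  then at \<open>x\<close>, and the velocity becomes the corresponding weighted mean. This is Laplace's method
  (\<open>gaussian_concentration\<close>).

  Averaging the two-state data at scale \<open>\<epsilon>\<close> changes them only in the layer \<open>[-\<epsilon>, \<epsilon>]\<close>, where the step
  becomes \<open>H(s/\<epsilon>)\<close> with \<open>H\<close> the cumulative distribution function of the kernel. Particles that start
  outside the layer form two beams: the left state travelling at speed \<open>u1\<close> and the right state
  travelling at speed \<open>u1 + u2\<close>. Since \<open>u2 < 0\<close> these beams overlap for \<open>(u1 + u2) t < x < u1 t\<close>.
  A particle that starts in the layer at \<open>\<epsilon> y\<close> reaches \<open>x\<close> only if \<open>H(y)\<close> is close to the level
  \<open>h = (x - u1 t) / (u2 t)\<close>, and its density contribution is
  \<open>O(\<epsilon> / \<bar>\<epsilon> + u2 t \<eta>(y)\<bar>)\<close>. If \<open>h\<close> is a regular value of \<open>H\<close>, then \<open>\<eta>\<close> is bounded away from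
  zero near the only relevant \<open>y\<close>, so the layer has exactly one relevant particle for every small \<open>\<epsilon>\<close>
  and contributes \<open>O(\<epsilon>)\<close> (\<open>layer_contribution\<close>). By Sard's theorem almost every level is regular,
  hence so is the level of almost every \<open>(t, x)\<close> (\<open>AE_regular_level\<close>).

  So the FP-solution is almost everywhere the superposition of the two beams
  (\<open>FP_limits_riemann\<close>), and any density that is rigidly translated at a constant speed \<open>v\<close> satisfies
  the conservation law with flux \<open>v\<close> times the density (\<open>transport_integral\<close>). Applied to the masses
  and to the momenta of the beams this gives both equations. The momentum flux found in this way is
  the sum of mass times squared velocity over the two beams; in the overlap it exceeds density times
  squared mean velocity by the variance term \<open>f1 (f1 + f2) u2\<^sup>2 / (2 f1 + f2)\<close>, which is the pressure
  (\<open>mixture_second_moment\<close>, \<open>two_beams_equation_of_state\<close>).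
\<close>

section \<open>Concentration of Gaussian weights\<close>

lemma gaussian_integral:
  fixes D t :: real
  assumes "D \<noteq> 0" "t > 0"
  shows "integrable lborel (\<lambda>r. exp (- ((D * r)\<^sup>2 / (2 * t))))"
    and "(\<integral>r. exp (- ((D * r)\<^sup>2 / (2 * t))) \<partial>lborel) = sqrt (2 * pi * t) / \<bar>D\<bar>"
proof -
  have sd: "0 < sqrt t / \<bar>D\<bar>" using assms by simp
  have var: "(sqrt t / \<bar>D\<bar>)\<^sup>2 = t / D\<^sup>2" using assms by (simp add: power_divide)
  have rt: "sqrt (2 * pi * (t / D\<^sup>2)) = sqrt (2 * pi * t) / \<bar>D\<bar>"
    by (simp add: real_sqrt_divide real_sqrt_mult)
  have pos: "sqrt (2 * pi * t) / \<bar>D\<bar> > 0" using assms by simp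
  have eq: "exp (- ((D * r)\<^sup>2 / (2 * t)))
      = sqrt (2 * pi * t) / \<bar>D\<bar> * normal_density 0 (sqrt t / \<bar>D\<bar>) r" for r
    using pos assms unfolding normal_density_def var rt
    by (simp add: power_mult_distrib field_simps)
  show "integrable lborel (\<lambda>r. exp (- ((D * r)\<^sup>2 / (2 * t))))"
    unfolding eq using sd by (intro integrable_mult_right integrable_normal_density)
  show "(\<integral>r. exp (- ((D * r)\<^sup>2 / (2 * t))) \<partial>lborel) = sqrt (2 * pi * t) / \<bar>D\<bar>"
    unfolding eq using sd by simp
qed

text \<open>
  The lower bound on the phase is what makes the weight integrable on an unbounded set: it puts the
  integrand below a Gaussian centred at \<open>s0\<close>.
\<close>
lemma gaussian_concentration_integrable:
  fixes F \<Phi> :: "real \<Rightarrow> real"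
  assumes [measurable]: "A \<in> sets borel" "F \<in> borel_measurable borel" "\<Phi> \<in> borel_measurable borel"
    and M: "\<And>s. \<bar>F s\<bar> \<le> M" and c: "c > 0" "\<And>s. s \<in> A \<Longrightarrow> c * \<bar>s - s0\<bar> \<le> \<bar>\<Phi> s\<bar>"
    and t: "t > 0" and \<sigma>: "\<sigma> > 0"
  shows "integrable lborel (\<lambda>s. indicator A s * (F s * exp (- ((\<Phi> s)\<^sup>2 / (2 * \<sigma>\<^sup>2 * t)))))"
proof -
  have i1: "integrable lborel (\<lambda>r. exp (- ((c * r)\<^sup>2 / (2 * (\<sigma>\<^sup>2 * t)))))"
    by (rule gaussian_integral) (use c t \<sigma> in auto)
  have int: "integrable lborel (\<lambda>s. M * exp (- ((c * (- s0 + 1 * s))\<^sup>2 / (2 * (\<sigma>\<^sup>2 * t)))))"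
    by (intro integrable_mult_right lborel_integrable_real_affine[OF i1]) simp
  have M0: "M \<ge> 0" using M[of 0] by linarith
  show ?thesis
  proof (rule Bochner_Integration.integrable_bound[OF int], measurable, rule AE_I2)
    fix s
    have "\<bar>indicator A s * (F s * exp (- ((\<Phi> s)\<^sup>2 / (2 * \<sigma>\<^sup>2 * t))))\<bar>
        \<le> M * exp (- ((c * (- s0 + 1 * s))\<^sup>2 / (2 * (\<sigma>\<^sup>2 * t))))"
    proof (cases "s \<in> A")
      case True
      have "(c * (- s0 + 1 * s))\<^sup>2 \<le> (\<Phi> s)\<^sup>2"
        using c(1) c(2)[OF True] by (intro abs_le_square_iff[THEN iffD1]) (simp add: abs_mult)
      then have "exp (- ((\<Phi> s)\<^sup>2 / (2 * \<sigma>\<^sup>2 * t))) \<le> exp (- ((c * (- s0 + 1 * s))\<^sup>2 / (2 * (\<sigma>\<^sup>2 * t))))"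
        using t \<sigma> by (simp add: divide_right_mono mult.assoc)
      then have "\<bar>F s\<bar> * exp (- ((\<Phi> s)\<^sup>2 / (2 * \<sigma>\<^sup>2 * t)))
          \<le> M * exp (- ((c * (- s0 + 1 * s))\<^sup>2 / (2 * (\<sigma>\<^sup>2 * t))))"
        using M[of s] M0 by (intro mult_mono) auto
      then show ?thesis using True by (simp add: abs_mult)
    qed (use M0 in simp)
    then show "norm (indicator A s * (F s * exp (- ((\<Phi> s)\<^sup>2 / (2 * \<sigma>\<^sup>2 * t)))))
        \<le> norm (M * exp (- ((c * (- s0 + 1 * s))\<^sup>2 / (2 * (\<sigma>\<^sup>2 * t)))))"
      using M0 by (simp add: abs_mult)
  qed
qed

text \<open>
  Laplace's method. After the substitution \<open>s = s0 + \<sigma> r\<close> the phase divided by \<open>\<sigma>\<close> tends to its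
  linearisation \<open>D r\<close>, and its lower bound supplies the Gaussian majorant for dominated convergence.
  The point \<open>s0\<close> must avoid the frontier of \<open>A\<close>, because otherwise only part of the Gaussian is seen.
  Besides its use around a zero of \<open>\<Phi>\<close>, the lemma covers sets without a zero: there \<open>s0\<close> may be any
  point off the closure of \<open>A\<close>.
\<close>
lemma gaussian_concentration:
  fixes F \<Phi> :: "real \<Rightarrow> real"
  assumes [measurable]: "A \<in> sets borel" "F \<in> borel_measurable borel" "\<Phi> \<in> borel_measurable borel"
    and M: "\<And>s. \<bar>F s\<bar> \<le> M" and c: "c > 0" "\<And>s. s \<in> A \<Longrightarrow> c * \<bar>s - s0\<bar> \<le> \<bar>\<Phi> s\<bar>"
    and t: "t > 0" and front: "s0 \<notin> frontier A"
    and zero: "s0 \<in> A \<Longrightarrow> isCont F s0 \<and> (\<Phi> has_real_derivative D) (at s0) \<and> \<Phi> s0 = 0 \<and> D \<noteq> 0"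
  shows "((\<lambda>\<sigma>. 1 / (sqrt (2 * pi * t) * \<sigma>) *
            (\<integral>s. indicator A s * (F s * exp (- ((\<Phi> s)\<^sup>2 / (2 * \<sigma>\<^sup>2 * t)))) \<partial>lborel))
          \<longlongrightarrow> (if s0 \<in> A then F s0 / \<bar>D\<bar> else 0)) (at_right 0)"
proof -
  \<comment> \<open>integrand in the rescaled variable, and its limit as \<open>\<sigma> \<rightarrow> 0\<close>\<close>
  define W where "W \<sigma> r = indicator A (s0 + \<sigma> * r) *
      (F (s0 + \<sigma> * r) * exp (- ((\<Phi> (s0 + \<sigma> * r))\<^sup>2 / (2 * \<sigma>\<^sup>2 * t))))" for \<sigma> r
  define w where "w r = indicator A s0 * (F s0 * exp (- ((D * r)\<^sup>2 / (2 * t))))" for r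
  have M0: "M \<ge> 0" using M[of 0] by linarith
  have [measurable]: "W \<sigma> \<in> borel_measurable borel" "w \<in> borel_measurable borel" for \<sigma>
    unfolding W_def w_def by measurable
  have lim: "(\<lambda>n. \<integral>r. W (X n) r \<partial>lborel) \<longlonglongrightarrow> (\<integral>r. w r \<partial>lborel)"
    if X: "\<And>n. X n > 0" "X \<longlonglongrightarrow> 0" for X :: "nat \<Rightarrow> real"
  proof (rule integral_dominated_convergence[where w = "\<lambda>r. M * exp (- ((c * r)\<^sup>2 / (2 * t)))"])
    show "integrable lborel (\<lambda>r. M * exp (- ((c * r)\<^sup>2 / (2 * t))))"
      using c t by (intro integrable_mult_right gaussian_integral) auto
    show "AE r in lborel. norm (W (X n) r) \<le> M * exp (- ((c * r)\<^sup>2 / (2 * t)))" for n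
    proof (rule AE_I2)
      fix r
      show "norm (W (X n) r) \<le> M * exp (- ((c * r)\<^sup>2 / (2 * t)))"
      proof (cases "s0 + X n * r \<in> A")
        case True
        have "X n > 0" by (rule X)
        have "(c * (X n * r))\<^sup>2 \<le> (\<Phi> (s0 + X n * r))\<^sup>2"
          using c(1) c(2)[OF True] by (intro abs_le_square_iff[THEN iffD1]) (simp add: abs_mult)
        then have "(c * (X n * r))\<^sup>2 / (2 * (X n)\<^sup>2 * t) \<le> (\<Phi> (s0 + X n * r))\<^sup>2 / (2 * (X n)\<^sup>2 * t)"
          using t by (intro divide_right_mono) auto
        moreover have "(c * (X n * r))\<^sup>2 / (2 * (X n)\<^sup>2 * t) = (c * r)\<^sup>2 / (2 * t)"
          using \<open>X n > 0\<close> by (simp add: power_mult_distrib)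
        ultimately have "\<bar>F (s0 + X n * r)\<bar> * exp (- ((\<Phi> (s0 + X n * r))\<^sup>2 / (2 * (X n)\<^sup>2 * t)))
            \<le> M * exp (- ((c * r)\<^sup>2 / (2 * t)))"
          using M[of "s0 + X n * r"] M0 by (intro mult_mono) auto
        then show ?thesis using True by (simp add: W_def abs_mult)
      qed (use M0 in \<open>simp add: W_def\<close>)
    qed
    show "AE r in lborel. (\<lambda>n. W (X n) r) \<longlonglongrightarrow> w r"
    proof (rule AE_I2)
      fix r
      have pt: "(\<lambda>n. s0 + X n * r) \<longlonglongrightarrow> s0"
        using tendsto_add[OF tendsto_const[of s0] tendsto_mult[OF X(2) tendsto_const[of r]]] by simp
      show "(\<lambda>n. W (X n) r) \<longlonglongrightarrow> w r"
      proof (cases "s0 \<in> A")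
        case True
        then have "s0 \<in> interior A" using front by (simp add: frontier_def closure_def)
        then have "eventually (\<lambda>n. s0 + X n * r \<in> interior A) sequentially"
          using topological_tendstoD[OF pt open_interior] by blast
        then have evA: "eventually (\<lambda>n. F (s0 + X n * r) *
             exp (- ((\<Phi> (s0 + X n * r) / X n)\<^sup>2 / (2 * t))) = W (X n) r) sequentially"
        proof eventually_elim
          case (elim n)
          then have "s0 + X n * r \<in> A" using interior_subset by blast
          then show ?case using X(1)[of n] by (simp add: W_def power_divide mult_ac)
        qed
        have Fl: "(\<lambda>n. F (s0 + X n * r)) \<longlonglongrightarrow> F s0"
          using zero[OF True] pt isCont_tendsto_compose by blast
        have \<Phi>l: "(\<lambda>n. \<Phi> (s0 + X n * r) / X n) \<longlonglongrightarrow> D * r"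
        proof (cases "r = 0")
          case False
          have h: "filterlim (\<lambda>n. X n * r) (at 0) sequentially"
            unfolding filterlim_at
          proof
            show "\<forall>\<^sub>F n in sequentially. X n * r \<in> UNIV \<and> X n * r \<noteq> 0"
              using X(1) False by (simp add: less_imp_neq[THEN not_sym])
            show "(\<lambda>n. X n * r) \<longlonglongrightarrow> 0"
              using tendsto_mult[OF X(2) tendsto_const[of r]] by simp
          qed
          have "((\<lambda>h. (\<Phi> (s0 + h) - \<Phi> s0) / h) \<longlongrightarrow> D) (at 0)"
            using zero[OF True] unfolding DERIV_def by blast
          then have "(\<lambda>n. \<Phi> (s0 + X n * r) / (X n * r)) \<longlonglongrightarrow> D"
            using filterlim_compose[OF _ h] zero[OF True] by fastforce
          then have "(\<lambda>n. \<Phi> (s0 + X n * r) / (X n * r) * r) \<longlonglongrightarrow> D * r"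
            by (intro tendsto_intros)
          then show ?thesis using False by simp
        qed (use zero[OF True] in simp)
        have "(\<lambda>n. F (s0 + X n * r) * exp (- ((\<Phi> (s0 + X n * r) / X n)\<^sup>2 / (2 * t)))) \<longlonglongrightarrow> w r"
          unfolding w_def using True t by (auto intro!: tendsto_intros Fl \<Phi>l)
        then show ?thesis using evA by (rule Lim_transform_eventually)
      next
        case False
        then have "s0 \<in> - closure A"
          using front interior_subset[of A] by (auto simp: frontier_def)
        then have "eventually (\<lambda>n. s0 + X n * r \<in> - closure A) sequentially"
          by (intro topological_tendstoD[OF pt]) auto
        then have "eventually (\<lambda>n. 0 = W (X n) r) sequentially"
          by eventually_elim (use closure_subset[of A] in \<open>auto simp: W_def indicator_def\<close>)
        then show ?thesis using False
          by (intro Lim_transform_eventually[OF tendsto_const]) (simp_all add: w_def)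
      qed
    qed
  qed measurable
  have "((\<lambda>\<sigma>. \<integral>r. W \<sigma> r \<partial>lborel) \<longlongrightarrow> (\<integral>r. w r \<partial>lborel)) (at_right 0)"
    by (rule tendsto_at_right_sequentially[of 0 1]) (use lim in auto)
  then have L: "((\<lambda>\<sigma>. (\<integral>r. W \<sigma> r \<partial>lborel) / sqrt (2 * pi * t))
      \<longlongrightarrow> (\<integral>r. w r \<partial>lborel) / sqrt (2 * pi * t)) (at_right 0)"
    using t by (intro tendsto_intros) auto
  have val: "(\<integral>r. w r \<partial>lborel) / sqrt (2 * pi * t) = (if s0 \<in> A then F s0 / \<bar>D\<bar> else 0)"
  proof (cases "s0 \<in> A")
    case True
    then have "D \<noteq> 0" using zero by blast
    then show ?thesis using True t unfolding w_def by (simp add: gaussian_integral(2))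
  qed (simp add: w_def)
  have ev: "\<forall>\<^sub>F \<sigma> in at_right 0. (\<integral>r. W \<sigma> r \<partial>lborel) / sqrt (2 * pi * t) = 1 / (sqrt (2 * pi * t) * \<sigma>) *
            (\<integral>s. indicator A s * (F s * exp (- ((\<Phi> s)\<^sup>2 / (2 * \<sigma>\<^sup>2 * t)))) \<partial>lborel)"
    unfolding eventually_at_right_field
  proof (intro exI[of _ 1] conjI allI impI)
    fix \<sigma> :: real assume "0 < \<sigma>"
    then show "(\<integral>r. W \<sigma> r \<partial>lborel) / sqrt (2 * pi * t) = 1 / (sqrt (2 * pi * t) * \<sigma>) *
            (\<integral>s. indicator A s * (F s * exp (- ((\<Phi> s)\<^sup>2 / (2 * \<sigma>\<^sup>2 * t)))) \<partial>lborel)"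
      using lborel_integral_real_affine[of \<sigma> "\<lambda>s. indicator A s * (F s * exp (- ((\<Phi> s)\<^sup>2 / (2 * \<sigma>\<^sup>2 * t))))" s0]
      by (simp add: W_def)
  qed simp
  show ?thesis
    using Lim_transform_eventually[OF L ev] unfolding val .
qed

section \<open>The cumulative distribution of an averaging kernel\<close>

definition kernel_cdf :: "(real \<Rightarrow> real) \<Rightarrow> real \<Rightarrow> real" where
  "kernel_cdf \<eta> y = (LINT z|lborel. indicator {..y} z * \<eta> z)"

lemma averaging_kernel_borel:
  assumes "averaging_kernel \<eta>"
  shows "\<eta> \<in> borel_measurable borel"
proof -
  \<comment> \<open>the values at the two end points are arbitrary and are split off\<close>
  have "(\<lambda>x. (indicator {-1<..<1} x *\<^sub>R \<eta> x) + indicator {-1} x * \<eta> (-1) + indicator {1} x * \<eta> 1)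
      \<in> borel_measurable borel"
    using assms by (intro borel_measurable_add borel_measurable_times borel_measurable_continuous_on_indicator)
      (auto simp: averaging_kernel_def)
  moreover have "(\<lambda>x. (indicator {-1<..<1} x *\<^sub>R \<eta> x) + indicator {-1} x * \<eta> (-1) + indicator {1} x * \<eta> 1) = \<eta>"
  proof
    fix x :: real
    have "x = 1 \<or> x = -1 \<or> x \<in> {-1<..<1} \<or> 1 < \<bar>x\<bar>"
      unfolding greaterThanLessThan_iff by arith
    then show "(indicator {-1<..<1} x *\<^sub>R \<eta> x) + indicator {-1} x * \<eta> (-1) + indicator {1} x * \<eta> 1 = \<eta> x"
      using assms by (elim disjE) (auto simp: averaging_kernel_def indicator_def)
  qed
  ultimately show ?thesis by metis
qed

lemma averaging_kernel_integrable:
  assumes "averaging_kernel \<eta>"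
  shows "integrable lborel \<eta>" "(LINT x|lborel. \<eta> x) = 1"
  using assms averaging_kernel_borel[OF assms]
  by (auto simp: averaging_kernel_def integrable_completion integral_completion)

text \<open>
  The substitution \<open>y = x - \<epsilon> z\<close> turns the half-line on which the step equals \<open>1\<close> into \<open>z \<le> x / \<epsilon>\<close>.
  Hence all scales share the single profile \<open>kernel_cdf \<eta>\<close>, and \<open>\<epsilon>\<close> only dilates it.
\<close>
lemma averaged_step:
  assumes k: "averaging_kernel \<eta>" and e: "\<epsilon> > 0"
  shows "averaged \<eta> \<epsilon> (\<lambda>x. a + b * heaviside x) x = a + b * kernel_cdf \<eta> (x / \<epsilon>)"
proof -
  note [measurable] = averaging_kernel_borel[OF k]
  have [measurable]: "heaviside \<in> borel_measurable borel"
    unfolding heaviside_def[abs_def] by measurable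
  have I: "integrable lborel (\<lambda>z. indicator {..x / \<epsilon>} z * \<eta> z)"
    by (rule Bochner_Integration.integrable_bound[OF averaging_kernel_integrable(1)[OF k]])
      (auto simp: indicator_def)
  have "averaged \<eta> \<epsilon> (\<lambda>x. a + b * heaviside x) x
      = (LINT y|lborel. \<eta> ((x - y) / \<epsilon>) / \<epsilon> * (a + b * heaviside y))"
    unfolding averaged_def by (rule integral_completion) measurable
  also have "\<dots> = (LINT z|lborel. \<eta> z * (a + b * heaviside (x - \<epsilon> * z)))"
    using e by (subst lborel_integral_real_affine[of "- \<epsilon>" _ x]) auto
  also have "\<dots> = (LINT z|lborel. a * \<eta> z + b * (indicator {..x / \<epsilon>} z * \<eta> z))"
    using e by (intro Bochner_Integration.integral_cong)
      (auto simp: heaviside_def indicator_def field_simps)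
  also have "\<dots> = a + b * kernel_cdf \<eta> (x / \<epsilon>)"
    using I averaging_kernel_integrable[OF k] by (simp add: kernel_cdf_def)
  finally show ?thesis .
qed

lemma kernel_cdf_mono:
  assumes k: "averaging_kernel \<eta>" shows "mono (kernel_cdf \<eta>)"
proof
  fix x y :: real assume "x \<le> y"
  note [measurable] = averaging_kernel_borel[OF k]
  have I: "integrable lborel (\<lambda>z. indicator {..w} z * \<eta> z)" for w
    by (rule Bochner_Integration.integrable_bound[OF averaging_kernel_integrable(1)[OF k]])
      (auto simp: indicator_def)
  show "kernel_cdf \<eta> x \<le> kernel_cdf \<eta> y"
    unfolding kernel_cdf_def using k \<open>x \<le> y\<close>
    by (intro integral_mono I) (auto simp: averaging_kernel_def indicator_def)
qed

lemma kernel_cdf_below: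
  assumes k: "averaging_kernel \<eta>" and "y \<le> -1" shows "kernel_cdf \<eta> y = 0"
  unfolding kernel_cdf_def
proof (rule integral_eq_zero_AE)
  show "AE z in lborel. indicator {..y} z * \<eta> z = 0"
    \<comment> \<open>for \<open>y = -1\<close> the integrand is \<open>\<eta> (-1)\<close> at the point \<open>-1\<close>, which may be nonzero\<close>
    using AE_lborel_singleton[of "-1"]
    by eventually_elim (use assms in \<open>auto simp: averaging_kernel_def indicator_def\<close>)
qed

lemma kernel_cdf_above:
  assumes k: "averaging_kernel \<eta>" and "y \<ge> 1" shows "kernel_cdf \<eta> y = 1"
proof -
  have "(\<lambda>z. indicator {..y} z * \<eta> z) = \<eta>"
    using assms by (intro ext) (auto simp: averaging_kernel_def indicator_def)
  then show ?thesis using averaging_kernel_integrable[OF k] by (simp add: kernel_cdf_def)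
qed

lemma kernel_cdf_range:
  assumes k: "averaging_kernel \<eta>" shows "kernel_cdf \<eta> y \<in> {0..1}"
proof -
  have "kernel_cdf \<eta> (min y (-2)) \<le> kernel_cdf \<eta> y" "kernel_cdf \<eta> y \<le> kernel_cdf \<eta> (max y 1)"
    using kernel_cdf_mono[OF k] by (auto intro: monoD)
  then show ?thesis
    using kernel_cdf_below[OF k, of "min y (-2)"] kernel_cdf_above[OF k, of "max y 1"] by auto
qed

lemma bounded_compose_kernel_cdf:
  fixes G :: "real \<Rightarrow> real"
  assumes k: "averaging_kernel \<eta>" and G: "continuous_on UNIV G"
  obtains M where "\<And>y. \<bar>G (kernel_cdf \<eta> y)\<bar> \<le> M"
proof -
  have "compact (G ` {0..1})"
    by (intro compact_continuous_image continuous_on_subset[OF G]) auto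
  then obtain M where M: "\<And>v. v \<in> {0..1} \<Longrightarrow> \<bar>G v\<bar> \<le> M"
    by (metis bounded_iff compact_imp_bounded image_eqI real_norm_def)
  then show thesis using kernel_cdf_range[OF k] by (intro that[of M]) blast
qed

lemma kernel_cdf_borel:
  assumes "averaging_kernel \<eta>" shows "kernel_cdf \<eta> \<in> borel_measurable borel"
  using kernel_cdf_mono[OF assms] by (rule borel_measurable_mono)

text \<open>
  The lower limit \<open>-2\<close> lies strictly to the left of the support, so that \<open>-1\<close> is an interior point when
  continuity is read off from the indefinite integral.
\<close>
lemma kernel_cdf_eq_integral:
  assumes k: "averaging_kernel \<eta>"
  shows "\<eta> integrable_on {-2..b}" "kernel_cdf \<eta> y = integral {-2..y} \<eta>"
proof -
  note [measurable] = averaging_kernel_borel[OF k]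
  have I: "set_integrable lborel {-2..w} \<eta>" for w
    unfolding set_integrable_def
    by (rule Bochner_Integration.integrable_bound[OF averaging_kernel_integrable(1)[OF k]])
      (auto simp: indicator_def)
  show "\<eta> integrable_on {-2..b}" using set_borel_integral_eq_integral(1)[OF I] .
  have "(\<lambda>z. indicator {..y} z * \<eta> z) = (\<lambda>z. indicator {-2..y} z *\<^sub>R \<eta> z)"
    using k by (intro ext) (auto simp: averaging_kernel_def indicator_def)
  then have "kernel_cdf \<eta> y = set_lebesgue_integral lborel {-2..y} \<eta>"
    by (simp add: kernel_cdf_def set_lebesgue_integral_def)
  then show "kernel_cdf \<eta> y = integral {-2..y} \<eta>"
    using set_borel_integral_eq_integral(2)[OF I] by simp
qed

lemma kernel_cdf_continuous:
  assumes k: "averaging_kernel \<eta>" shows "isCont (kernel_cdf \<eta>) y"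
proof (cases "y < -1")
  case True
  have "\<forall>\<^sub>F x in at y. kernel_cdf \<eta> x = kernel_cdf \<eta> y"
    using eventually_at_in_open'[of "{..< -1}" y] True
    by (auto simp: kernel_cdf_below[OF k] elim: eventually_mono)
  then show ?thesis unfolding isCont_def by (rule tendsto_eventually)
next
  case False
  have "continuous_on {-2..y+1} (kernel_cdf \<eta>)"
    using indefinite_integral_continuous_1[OF kernel_cdf_eq_integral(1)[OF k]]
    by (simp add: kernel_cdf_eq_integral(2)[OF k])
  moreover have "y \<in> interior {-2..y+1}" using False by simp
  ultimately show ?thesis by (rule continuous_on_interior)
qed

text \<open>
  At the end points of the support the kernel may jump, as the box kernel does, or be unbounded; hence the
  open interval.
\<close>
lemma kernel_cdf_deriv:
  assumes k: "averaging_kernel \<eta>" and y: "y \<in> {-1<..<1}"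
  shows "(kernel_cdf \<eta> has_real_derivative \<eta> y) (at y)"
proof -
  have "isCont \<eta> y"
    using k y by (simp add: averaging_kernel_def continuous_on_eq_continuous_at)
  then have "continuous (at y within ({-2..2} - {})) \<eta>" by (rule continuous_at_imp_continuous_at_within)
  then have "((\<lambda>u. integral {-2..u} \<eta>) has_vector_derivative \<eta> y) (at y within ({-2..2} - {}))"
    using y by (intro integral_has_vector_derivative_continuous_at kernel_cdf_eq_integral(1)[OF k]) auto
  moreover have "at y within ({-2..2} - {}) = at y"
    using y by (intro at_within_interior) auto
  ultimately show ?thesis
    by (simp add: kernel_cdf_eq_integral(2)[OF k, abs_def] has_real_derivative_iff_has_vector_derivative)
qed

section \<open>Regular levels\<close>

text \<open>
  Regular values of the profile on \<open>{-1<..<1}\<close>, without the end levels \<open>0\<close> and \<open>1\<close>: these belong to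
  the points \<open>x = u1 t\<close> and \<open>x = (u1 + u2) t\<close> on the fronts of the two beams.
\<close>
definition regular_level :: "(real \<Rightarrow> real) \<Rightarrow> real \<Rightarrow> bool" where
  "regular_level \<eta> h \<longleftrightarrow> h \<noteq> 0 \<and> h \<noteq> 1 \<and> (\<forall>y\<in>{-1<..<1}. kernel_cdf \<eta> y = h \<longrightarrow> \<eta> y \<noteq> 0)"

text \<open>
  The one-dimensional case of Sard's theorem, read off from the one for maps of \<open>real^1\<close> by transporting
  the function along the coordinate isomorphism.
\<close>
lemma Sard_real:
  fixes f :: "real \<Rightarrow> real"
  assumes "\<And>x. x \<in> S \<Longrightarrow> (f has_real_derivative 0) (at x)"
  shows "negligible (f ` S)"
proof -
  define g :: "real^1 \<Rightarrow> real^1" where "g v = vec (f (v $ 1))" for v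
  have der: "(g has_derivative (\<lambda>_. 0)) (at v within {v. v $ 1 \<in> S})" if "v $ 1 \<in> S" for v
  proof -
    have "(f has_derivative (\<lambda>_. 0)) (at (v $ 1))"
      using assms[OF that] by (simp add: has_field_derivative_def lambda_zero)
    then have "((\<lambda>w. f (w $ 1)) has_derivative (\<lambda>_. 0)) (at v within {v. v $ 1 \<in> S})"
      using diff_chain_within[of "\<lambda>w. w $ 1" "\<lambda>w. w $ 1" v "{v. v $ 1 \<in> S}" f "\<lambda>_. 0"]
      by (simp add: o_def bounded_linear_imp_has_derivative bounded_linear_vec_nth has_derivative_at_withinI)
    then have "((\<lambda>w. f (w $ 1) *\<^sub>R (vec 1 :: real^1)) has_derivative (\<lambda>_. 0)) (at v within {v. v $ 1 \<in> S})"
      using has_derivative_scaleR_left by fastforce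
    moreover have "(\<lambda>w. f (w $ 1) *\<^sub>R (vec 1 :: real^1)) = g"
      by (auto simp: g_def vec_eq_iff)
    ultimately show ?thesis by simp
  qed
  have "negligible (g ` {v. v $ 1 \<in> S})"
  proof (rule baby_Sard[OF _ der])
    show "rank (matrix (\<lambda>_::real^1. 0 :: real^1)) < CARD(1)"
      by (simp add: matrix_def flip: zero_vec_def)
  qed auto
  then have "negligible ((\<lambda>v::real^1. v $ 1) ` (g ` {v. v $ 1 \<in> S}))"
    by (rule negligible_differentiable_image_negligible[rotated])
       (auto intro: linear_imp_differentiable_on simp: bounded_linear.linear bounded_linear_vec_nth)
  moreover have "f ` S \<subseteq> (\<lambda>v::real^1. v $ 1) ` (g ` {v. v $ 1 \<in> S})"
  proof
    fix z assume "z \<in> f ` S"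
    then obtain x where "x \<in> S" "z = f x" by blast
    then show "z \<in> (\<lambda>v::real^1. v $ 1) ` (g ` {v. v $ 1 \<in> S})"
      by (auto simp: g_def image_image intro!: image_eqI[of _ _ "vec x"])
  qed
  ultimately show ?thesis by (rule negligible_subset)
qed

lemma negligible_irregular_levels:
  assumes k: "averaging_kernel \<eta>"
  shows "negligible {h. \<not> regular_level \<eta> h}"
proof -
  have "{h. \<not> regular_level \<eta> h} = {0, 1} \<union> kernel_cdf \<eta> ` {y \<in> {-1<..<1}. \<eta> y = 0}"
    by (auto simp: regular_level_def)
  moreover have "negligible (kernel_cdf \<eta> ` {y \<in> {-1<..<1}. \<eta> y = 0})"
    using kernel_cdf_deriv[OF k] by (intro Sard_real) fastforce
  ultimately show ?thesis by simp
qed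

text \<open>
  For fixed \<open>t > 0\<close> the level depends affinely on \<open>x\<close>, so the irregular points form a null set on each
  line of constant \<open>t\<close>, and Fubini's theorem applies once the irregular levels are enclosed in a Borel null set.
\<close>
lemma AE_regular_level:
  assumes k: "averaging_kernel \<eta>" and u2: "u2 \<noteq> 0"
  shows "AE z in lebesgue. 0 < fst z \<longrightarrow> regular_level \<eta> ((snd z - u1 * fst z) / (u2 * fst z))"
proof -
  obtain N where N: "{h. \<not> regular_level \<eta> h} \<subseteq> N" "N \<in> null_sets lborel"
    using negligible_irregular_levels[OF k] null_sets_completion_iff2
    by (metis negligible_iff_null_sets)
  have [measurable]: "N \<in> sets borel" using N(2) by auto
  let ?P = "\<lambda>z. 0 < fst z \<longrightarrow> (snd z - u1 * fst z) / (u2 * fst z) \<notin> N"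
  have "AE z in lborel \<Otimes>\<^sub>M lborel. ?P z"
  proof (rule lborel_pair.AE_pair_measure)
    show "AE t in lborel. AE x in lborel. ?P (t, x)"
    proof (rule AE_I2)
      fix t :: real
      show "AE x in lborel. ?P (t, x)"
      proof (cases "0 < t")
        case True
        have "AE h in lborel. h \<notin> N" using N(2) by (rule AE_not_in)
        then have "AE x in lborel. (- (u1 / u2)) + (1 / (u2 * t)) * x \<notin> N"
          using True u2 by (intro AE_borel_affine) auto
        moreover have "(x - u1 * t) / (u2 * t) = (- (u1 / u2)) + (1 / (u2 * t)) * x" for x
          using True u2 by (simp add: field_simps)
        ultimately show ?thesis by simp
      qed simp
    qed
  qed measurable
  then have "AE z in lborel. ?P z" unfolding lborel_prod .
  then have "AE z in lborel. 0 < fst z \<longrightarrow> regular_level \<eta> ((snd z - u1 * fst z) / (u2 * fst z))"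
    by eventually_elim (use N(1) in blast)
  then show ?thesis by (rule AE_completion)
qed

section \<open>Vanishing contribution of the transition layer\<close>

text \<open>
  The profile is monotone and crosses a regular level with positive slope, so the crossing point \<open>y0\<close> is
  unique and \<open>\<eta>\<close> has a positive lower bound \<open>\<mu>\<close> near it. The mean value theorem gives growth at rate \<open>\<mu>\<close>
  near \<open>y0\<close>; since what has grown there is never lost, a smaller rate \<open>m\<close> works on all of \<open>{-1..1}\<close>.
\<close>
lemma regular_level_linear_growth:
  assumes k: "averaging_kernel \<eta>" and reg: "regular_level \<eta> h" and h: "0 < h" "h < 1"
  obtains y0 \<delta> m where "\<delta> > 0" "m > 0" "{y0 - \<delta>..y0 + \<delta>} \<subseteq> {-1<..<1}" "kernel_cdf \<eta> y0 = h"
    "\<And>y. y \<in> {y0 - \<delta>..y0 + \<delta>} \<Longrightarrow> m \<le> \<eta> y"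
    "\<And>y z. y \<in> {y0 - \<delta>..y0 + \<delta>} \<Longrightarrow> z \<in> {-1..1} \<Longrightarrow> m * \<bar>z - y\<bar> \<le> \<bar>kernel_cdf \<eta> z - kernel_cdf \<eta> y\<bar>"
proof -
  let ?H = "kernel_cdf \<eta>"
  have mono: "?H a \<le> ?H b" if "a \<le> b" for a b using kernel_cdf_mono[OF k] that by (rule monoD)
  have H0: "?H (-1) = 0" and H1: "?H 1 = 1"
    using kernel_cdf_below[OF k, of "-1"] kernel_cdf_above[OF k, of 1] by auto
  have "\<exists>y\<ge>-1. y \<le> 1 \<and> ?H y = h"
    using h H0 H1 by (intro IVT') (auto intro: continuous_at_imp_continuous_on kernel_cdf_continuous[OF k])
  then obtain y0 where y0: "-1 \<le> y0" "y0 \<le> 1" "?H y0 = h" by blast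
  have "y0 \<noteq> -1" "y0 \<noteq> 1" using y0 H0 H1 h by auto
  then have y0in: "-1 < y0" "y0 < 1" using y0 by auto
  have pos: "\<eta> y0 > 0"
    using reg y0in y0 k by (force simp: regular_level_def averaging_kernel_def order_less_le)
  define \<mu> where "\<mu> = \<eta> y0 / 2"
  have \<mu>: "\<mu> > 0" using pos by (simp add: \<mu>_def)
  have "isCont \<eta> y0"
    using k y0in by (simp add: averaging_kernel_def continuous_on_eq_continuous_at)
  then have "(\<eta> \<longlongrightarrow> \<eta> y0) (nhds y0)" by (simp add: isCont_def tendsto_at_iff_tendsto_nhds)
  then have "\<forall>\<^sub>F y in nhds y0. \<mu> < \<eta> y"
    by (rule order_tendstoD) (use pos in \<open>simp add: \<mu>_def\<close>)
  then obtain r where r: "r > 0" "\<And>y. \<bar>y - y0\<bar> < r \<Longrightarrow> \<mu> < \<eta> y"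
    unfolding eventually_nhds_metric dist_real_def by blast
  define d where "d = min (r / 2) ((1 - \<bar>y0\<bar>) / 2)"
  have "d > 0" using r(1) y0in by (auto simp: d_def)
  moreover have "d \<le> r / 2" "d \<le> (1 - \<bar>y0\<bar>) / 2"
    unfolding d_def by (rule min.cobounded1, rule min.cobounded2)
  ultimately have d: "d > 0" "d < r" "d \<le> 1" "d < 1 - y0" "d < 1 + y0"
    using r(1) y0in abs_ge_zero[of y0] abs_ge_self[of y0] abs_ge_minus_self[of y0]
    by (simp_all add: field_simps)
  have win: "\<mu> \<le> \<eta> y" "y \<in> {-1<..<1}" if "y \<in> {y0 - d..y0 + d}" for y
  proof -
    have "\<bar>y - y0\<bar> < r" using that d unfolding atLeastAtMost_iff by linarith
    then show "\<mu> \<le> \<eta> y" using r(2) by (simp add: less_imp_le)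
    show "y \<in> {-1<..<1}" using that d by auto
  qed
  have grow: "\<mu> * (z - w) \<le> ?H z - ?H w" if "y0 - d \<le> w" "w \<le> z" "z \<le> y0 + d" for w z
  proof -
    have "?H w - \<mu> * w \<le> ?H z - \<mu> * z"
    proof (rule DERIV_nonneg_imp_nondecreasing[OF \<open>w \<le> z\<close>])
      fix y assume "w \<le> y" "y \<le> z"
      then have y: "y \<in> {y0 - d..y0 + d}" using that by auto
      then show "\<exists>D. ((\<lambda>y. ?H y - \<mu> * y) has_real_derivative D) (at y) \<and> 0 \<le> D"
        using win[OF y] by (intro exI[of _ "\<eta> y - \<mu>"]) (auto intro!: derivative_eq_intros kernel_cdf_deriv[OF k])
    qed
    then show ?thesis by (simp add: algebra_simps)
  qed
  \<comment> \<open>within the half window a gain of \<open>\<mu> d / 2\<close> is certain, and distances in \<open>{-1..1}\<close> are at most \<open>2\<close>\<close>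
  define m where "m = \<mu> * (d / 4)"
  have m: "m > 0" "m \<le> \<mu>" using \<mu> d by (auto simp: m_def mult_le_cancel_left1)
  have scale: "m * e \<le> \<mu> * min e (d / 2)" if "0 \<le> e" "e \<le> 2" for e
  proof -
    have "e * (d / 4) \<le> 2 * (d / 4)" "e * (d / 4) \<le> e * 1"
      using that d by (auto intro!: mult_right_mono mult_left_mono)
    then have "d / 4 * e \<le> min e (d / 2)" by (intro min.boundedI) (simp_all add: mult.commute)
    then have "\<mu> * (d / 4 * e) \<le> \<mu> * min e (d / 2)" using \<mu> by (intro mult_left_mono) auto
    then show ?thesis by (simp only: m_def mult.assoc)
  qed
  show thesis
  proof (rule that[of "d / 2" m y0])
    show "d / 2 > 0" "m > 0" "?H y0 = h" using d m y0 by auto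
    show "{y0 - d / 2..y0 + d / 2} \<subseteq> {-1<..<1}" using d by auto
    show "m \<le> \<eta> y" if "y \<in> {y0 - d / 2..y0 + d / 2}" for y
      using win(1)[of y] that m d by fastforce
    show "m * \<bar>z - y\<bar> \<le> \<bar>?H z - ?H y\<bar>" if y: "y \<in> {y0 - d / 2..y0 + d / 2}" and z: "z \<in> {-1..1}" for y z
    proof (cases "y \<le> z")
      case True
      have "m * (z - y) \<le> \<mu> * min (z - y) (d / 2)"
        using win(2)[of y] y z d True by (intro scale) auto
      also have "\<dots> \<le> \<mu> * (min z (y0 + d) - y)"
        using \<mu> y by (intro mult_left_mono) auto
      also have "\<dots> \<le> ?H (min z (y0 + d)) - ?H y" using y d True by (intro grow) auto
      also have "\<dots> \<le> ?H z - ?H y" using mono[of "min z (y0 + d)" z] by auto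
      finally show ?thesis using True mono[OF True] by simp
    next
      case False
      have "m * (y - z) \<le> \<mu> * min (y - z) (d / 2)"
        using win(2)[of y] y z d False by (intro scale) auto
      also have "\<dots> \<le> \<mu> * (y - max z (y0 - d))"
        using \<mu> y by (intro mult_left_mono) auto
      also have "\<dots> \<le> ?H y - ?H (max z (y0 - d))" using y d False by (intro grow) auto
      also have "\<dots> \<le> ?H y - ?H z" using mono[of z "max z (y0 - d)"] by auto
      finally show ?thesis using False mono[of z y] by (simp add: abs_real_def)
    qed
  qed
qed

text \<open>
  With \<open>a = - u2 t\<close> and \<open>s = \<epsilon> y\<close> the phase is \<open>\<epsilon> y - a (H(y) - h)\<close>. If \<open>h\<close> is outside \<open>{0..1}\<close> it has
  no zero for small \<open>\<epsilon>\<close> and the limit vanishes. Otherwise it is a small perturbation of \<open>- a (H(y) - h)\<close>,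
  which by \<open>regular_level_linear_growth\<close> leaves exactly one zero, with a phase that grows linearly away
  from it. As a function of \<open>s\<close> the phase has slope at least of order \<open>1 / \<epsilon>\<close>
  there, so the contribution is of order \<open>\<epsilon>\<close>.
\<close>
lemma layer_contribution:
  fixes G :: "real \<Rightarrow> real"
  assumes k: "averaging_kernel \<eta>" and G: "continuous_on UNIV G" and t: "t > 0" and u2: "u2 < 0"
    and reg: "regular_level \<eta> ((x - u1 * t) / (u2 * t))"
  shows "\<exists>B. \<forall>\<^sub>F \<epsilon> in at_right 0. \<exists>l.
     ((\<lambda>\<sigma>. 1 / (sqrt (2 * pi * t) * \<sigma>) * (LINT s|lborel. indicator {-\<epsilon>..\<epsilon>} s * (G (kernel_cdf \<eta> (s / \<epsilon>)) *
        exp (- (((u1 + u2 * kernel_cdf \<eta> (s / \<epsilon>)) * t + s - x)\<^sup>2 / (2 * \<sigma>\<^sup>2 * t)))))) \<longlongrightarrow> l) (at_right 0) \<and>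
     \<bar>l\<bar> \<le> B * \<epsilon>"
proof -
  let ?H = "kernel_cdf \<eta>"
  note [measurable] = kernel_cdf_borel[OF k] borel_measurable_continuous_onI[OF G]
  define h where "h = (x - u1 * t) / (u2 * t)"
  define a where "a = - u2 * t"
  have a: "a > 0" using t u2 by (simp add: a_def mult_neg_pos)
  have ht: "u1 * t - x = a * h" using t u2 by (simp add: h_def a_def)
  have \<Phi>: "(u1 + u2 * ?H y) * t + s - x = s - a * (?H y - h)" for y s
    using ht by (simp add: a_def algebra_simps)
  obtain M where GM: "\<And>y. \<bar>G (?H y)\<bar> \<le> M" using bounded_compose_kernel_cdf[OF k G] by blast
  have M0: "M \<ge> 0" using GM[of 0] by linarith
  show ?thesis
  proof (cases "0 < h \<and> h < 1")
    case False
    define r where "r = (if h < 0 then - h else h - 1)"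
    have "h \<noteq> 0" "h \<noteq> 1" using reg unfolding h_def regular_level_def by blast+
    then have r: "r > 0" using False by (auto simp: r_def)
    have Hr: "r \<le> \<bar>?H y - h\<bar>" for y
      using kernel_cdf_range[OF k, of y] False by (auto simp: r_def abs_real_def)
    have "\<forall>\<^sub>F \<epsilon> in at_right 0. 0 < \<epsilon> \<and> \<epsilon> < a * r / 2"
      using a r by (auto simp: eventually_at_right_field intro!: exI[of _ "a * r / 2"])
    then have "\<forall>\<^sub>F \<epsilon> in at_right 0. ((\<lambda>\<sigma>. 1 / (sqrt (2 * pi * t) * \<sigma>) * (LINT s|lborel. indicator {-\<epsilon>..\<epsilon>} s * (G (?H (s / \<epsilon>)) *
        exp (- ((s - a * (?H (s / \<epsilon>) - h))\<^sup>2 / (2 * \<sigma>\<^sup>2 * t)))))) \<longlongrightarrow> 0) (at_right 0)"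
    proof eventually_elim
      case (elim \<epsilon>)
      have "((\<lambda>\<sigma>. 1 / (sqrt (2 * pi * t) * \<sigma>) * (LINT s|lborel. indicator {-\<epsilon>..\<epsilon>} s * (G (?H (s / \<epsilon>)) *
        exp (- ((s - a * (?H (s / \<epsilon>) - h))\<^sup>2 / (2 * \<sigma>\<^sup>2 * t))))))
        \<longlongrightarrow> (if 2 * \<epsilon> \<in> {-\<epsilon>..\<epsilon>} then G (?H (2 * \<epsilon> / \<epsilon>)) / \<bar>1\<bar> else 0)) (at_right 0)"
      \<comment> \<open>no zero in the layer: the reference point \<open>2 \<epsilon>\<close> is outside it, and all its distances to the layer are at most \<open>3 \<epsilon>\<close>\<close>
      proof (rule gaussian_concentration[where M = M and c = "a * r / 2 / (3 * \<epsilon>)"])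
        show "a * r / 2 / (3 * \<epsilon>) * \<bar>s - 2 * \<epsilon>\<bar> \<le> \<bar>s - a * (?H (s / \<epsilon>) - h)\<bar>" if "s \<in> {-\<epsilon>..\<epsilon>}" for s
        proof -
          have "a * r / 2 / (3 * \<epsilon>) * \<bar>s - 2 * \<epsilon>\<bar> \<le> a * r / 2 / (3 * \<epsilon>) * (3 * \<epsilon>)"
            using that elim a r by (intro mult_left_mono) auto
          also have "\<dots> = a * r / 2" using elim by simp
          also have "\<dots> \<le> \<bar>s - a * (?H (s / \<epsilon>) - h)\<bar>"
          proof -
            have "a * r \<le> \<bar>a * (?H (s / \<epsilon>) - h)\<bar>" using Hr a by (simp add: abs_mult)
            moreover have "\<bar>s\<bar> < a * r / 2" using that elim by auto
            ultimately show ?thesis by linarith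
          qed
          finally show ?thesis .
        qed
        show "2 * \<epsilon> \<notin> frontier {-\<epsilon>..\<epsilon>}" using elim by (simp add: frontier_def)
      qed (use elim a r t GM in auto)
      then show ?case using elim by simp
    qed
    then show ?thesis unfolding \<Phi>
      by (intro exI[of _ 0]) (auto elim!: eventually_mono)
  next
    case True
    have "regular_level \<eta> h" using reg by (simp add: h_def)
    then obtain y0 \<delta> m where w: "\<delta> > 0" "m > 0" "{y0 - \<delta>..y0 + \<delta>} \<subseteq> {-1<..<1}" "?H y0 = h"
      "\<And>y. y \<in> {y0 - \<delta>..y0 + \<delta>} \<Longrightarrow> m \<le> \<eta> y"
      "\<And>y z. y \<in> {y0 - \<delta>..y0 + \<delta>} \<Longrightarrow> z \<in> {-1..1} \<Longrightarrow> m * \<bar>z - y\<bar> \<le> \<bar>?H z - ?H y\<bar>"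
      using regular_level_linear_growth[OF k] True by metis
    have y0in: "y0 - \<delta> \<in> {-1<..<1}" "y0 + \<delta> \<in> {-1<..<1}"
      by (rule subsetD[OF w(3)], use w(1) in simp)+
    have mono: "?H p \<le> ?H q" if "p \<le> q" for p q using kernel_cdf_mono[OF k] that by (rule monoD)
    have right: "m * \<delta> \<le> ?H (y0 + \<delta>) - h"
      using w(6)[of y0 "y0 + \<delta>"] w(1,4) y0in mono[of y0 "y0 + \<delta>"] by auto
    have "m * \<delta> \<le> \<bar>?H (y0 - \<delta>) - h\<bar>" "?H (y0 - \<delta>) \<le> h"
      using w(6)[of y0 "y0 - \<delta>"] w(1,4) y0in mono[of "y0 - \<delta>" y0] by auto
    then have left: "m * \<delta> \<le> h - ?H (y0 - \<delta>)" by linarith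
    have "\<forall>\<^sub>F \<epsilon> in at_right 0. 0 < \<epsilon> \<and> \<epsilon> < a * (m * \<delta>) \<and> \<epsilon> < a * m / 2"
      unfolding eventually_at_right_field using a w(1,2)
      by (intro exI[of _ "min (a * (m * \<delta>)) (a * m / 2)"]) auto
    then have "\<forall>\<^sub>F \<epsilon> in at_right 0. \<exists>l. ((\<lambda>\<sigma>. 1 / (sqrt (2 * pi * t) * \<sigma>) * (LINT s|lborel. indicator {-\<epsilon>..\<epsilon>} s * (G (?H (s / \<epsilon>)) *
        exp (- ((s - a * (?H (s / \<epsilon>) - h))\<^sup>2 / (2 * \<sigma>\<^sup>2 * t)))))) \<longlongrightarrow> l) (at_right 0) \<and> \<bar>l\<bar> \<le> 2 * M / (a * m) * \<epsilon>"
    proof eventually_elim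
      case (elim \<epsilon>)
      \<comment> \<open>the particle of the layer that is at \<open>x\<close> at time \<open>t\<close>\<close>
      have "\<exists>y\<ge>y0 - \<delta>. y \<le> y0 + \<delta> \<and> \<epsilon> * y - a * (?H y - h) = 0"
      proof (rule IVT2')
        have "a * (m * \<delta>) \<le> a * (?H (y0 + \<delta>) - h)" using right a by simp
        moreover have "\<epsilon> * (y0 + \<delta>) \<le> \<epsilon> * 1" using elim y0in by (intro mult_left_mono) auto
        ultimately show "\<epsilon> * (y0 + \<delta>) - a * (?H (y0 + \<delta>) - h) \<le> 0" using elim by linarith
        have "a * (m * \<delta>) \<le> a * (h - ?H (y0 - \<delta>))" using left a by simp
        moreover have "\<epsilon> * (-1) \<le> \<epsilon> * (y0 - \<delta>)" using elim y0in by (intro mult_left_mono) auto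
        ultimately show "0 \<le> \<epsilon> * (y0 - \<delta>) - a * (?H (y0 - \<delta>) - h)"
          using elim by (simp add: algebra_simps)
        show "continuous_on {y0 - \<delta>..y0 + \<delta>} (\<lambda>y. \<epsilon> * y - a * (?H y - h))"
          by (intro continuous_intros continuous_at_imp_continuous_on ballI kernel_cdf_continuous[OF k])
      qed (use w in auto)
      then obtain y where y: "y \<in> {y0 - \<delta>..y0 + \<delta>}" and yz: "\<epsilon> * y = a * (?H y - h)" by auto
      have yin: "y \<in> {-1<..<1}" using y w(3) by blast
      define D where "D = 1 - a * (\<eta> y / \<epsilon>)"
      have "a * m \<le> a * \<eta> y" using w(5)[OF y] a by simp
      then have "a * m / \<epsilon> \<le> a * \<eta> y / \<epsilon>" using elim by (simp add: divide_right_mono)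
      moreover have "1 < a * m / 2 / \<epsilon>" using elim by (simp add: field_simps)
      ultimately have D: "a * m / 2 / \<epsilon> \<le> \<bar>D\<bar>" unfolding D_def by (simp add: abs_real_def)
      have Dpos: "0 < a * m / 2 / \<epsilon>" using a w(2) elim by simp
      have sin: "\<epsilon> * y \<in> {-\<epsilon><..<\<epsilon>}"
        using yin elim mult_strict_left_mono[of "-1" y \<epsilon>] mult_strict_left_mono[of y 1 \<epsilon>] by auto
      have "((\<lambda>\<sigma>. 1 / (sqrt (2 * pi * t) * \<sigma>) * (LINT s|lborel. indicator {-\<epsilon>..\<epsilon>} s * (G (?H (s / \<epsilon>)) *
        exp (- ((s - a * (?H (s / \<epsilon>) - h))\<^sup>2 / (2 * \<sigma>\<^sup>2 * t))))))
        \<longlongrightarrow> (if \<epsilon> * y \<in> {-\<epsilon>..\<epsilon>} then G (?H (\<epsilon> * y / \<epsilon>)) / \<bar>D\<bar> else 0)) (at_right 0)"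
      proof (rule gaussian_concentration[where M = M and c = "a * m / 2 / \<epsilon>"])
        show "a * m / 2 / \<epsilon> * \<bar>s - \<epsilon> * y\<bar> \<le> \<bar>s - a * (?H (s / \<epsilon>) - h)\<bar>" if s: "s \<in> {-\<epsilon>..\<epsilon>}" for s
        proof -
          define z where "z = s / \<epsilon>"
          have sz: "s = \<epsilon> * z" using elim by (simp add: z_def)
          have z: "z \<in> {-1..1}" using s elim by (auto simp: z_def field_simps)
          have "a * m / 2 / \<epsilon> * \<bar>s - \<epsilon> * y\<bar> = a * m / 2 * \<bar>z - y\<bar>"
            using elim by (simp add: sz abs_mult flip: right_diff_distrib)
          also have "\<dots> \<le> (a * m - \<epsilon>) * \<bar>z - y\<bar>" using elim by (intro mult_right_mono) auto
          also have "\<dots> \<le> \<bar>a * (?H z - ?H y)\<bar> - \<bar>\<epsilon> * (z - y)\<bar>"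
          proof -
            have "a * (m * \<bar>z - y\<bar>) \<le> a * \<bar>?H z - ?H y\<bar>"
              using w(6)[OF y z] a by (intro mult_left_mono) auto
            moreover have "\<bar>a * (?H z - ?H y)\<bar> = a * \<bar>?H z - ?H y\<bar>" "\<bar>\<epsilon> * (z - y)\<bar> = \<epsilon> * \<bar>z - y\<bar>"
              using a elim by (simp_all only: abs_mult abs_of_pos)
            ultimately show ?thesis by (simp only: left_diff_distrib mult.assoc)
          qed
          also have "\<dots> \<le> \<bar>\<epsilon> * (z - y) - a * (?H z - ?H y)\<bar>" by linarith
          also have "\<epsilon> * (z - y) - a * (?H z - ?H y) = s - a * (?H (s / \<epsilon>) - h)"
            using yz by (simp add: sz[symmetric] z_def[symmetric] algebra_simps)
          finally show ?thesis .
        qed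
        show "\<epsilon> * y \<notin> frontier {-\<epsilon>..\<epsilon>}" using sin yin by (simp add: frontier_def)
        have ey: "\<epsilon> * y / \<epsilon> = y" using elim by simp
        have "isCont (\<lambda>s. G (?H (s / \<epsilon>))) (\<epsilon> * y)"
        proof (rule isCont_o2[where f = "\<lambda>s. ?H (s / \<epsilon>)" and g = G])
          show "isCont (\<lambda>s. ?H (s / \<epsilon>)) (\<epsilon> * y)"
            by (rule isCont_o2[where f = "\<lambda>s. s / \<epsilon>" and g = ?H])
              (use elim in \<open>auto intro: kernel_cdf_continuous[OF k]\<close>)
          show "isCont G (?H (\<epsilon> * y / \<epsilon>))" using G by (simp add: continuous_on_eq_continuous_at)
        qed
        moreover have "((\<lambda>s. s - a * (?H (s / \<epsilon>) - h)) has_real_derivative D) (at (\<epsilon> * y))"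
        proof -
          have "((\<lambda>s. s / \<epsilon>) has_real_derivative 1 / \<epsilon>) (at (\<epsilon> * y))"
            using elim by (auto intro!: derivative_eq_intros)
          moreover have "(?H has_real_derivative \<eta> y) (at (\<epsilon> * y / \<epsilon>))"
            unfolding ey by (rule kernel_cdf_deriv[OF k yin])
          ultimately have "((\<lambda>s. ?H (s / \<epsilon>)) has_real_derivative \<eta> y * (1 / \<epsilon>)) (at (\<epsilon> * y))"
            by (intro DERIV_chain2)
          then show ?thesis unfolding D_def by (auto intro!: derivative_eq_intros)
        qed
        ultimately show "isCont (\<lambda>s. G (?H (s / \<epsilon>))) (\<epsilon> * y) \<and>
           ((\<lambda>s. s - a * (?H (s / \<epsilon>) - h)) has_real_derivative D) (at (\<epsilon> * y)) \<and>
           \<epsilon> * y - a * (?H (\<epsilon> * y / \<epsilon>) - h) = 0 \<and> D \<noteq> 0"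
          using yz ey D Dpos by auto
      qed (use elim a w(2) t GM in auto)
      moreover have "\<bar>G (?H y) / \<bar>D\<bar>\<bar> \<le> 2 * M / (a * m) * \<epsilon>"
      proof -
        have "\<bar>G (?H y) / \<bar>D\<bar>\<bar> \<le> M / (a * m / 2 / \<epsilon>)"
          using GM[of y] M0 D Dpos by (simp only: abs_divide abs_abs) (intro frac_le, auto)
        then show ?thesis by (simp add: mult_ac)
      qed
      ultimately show ?case using sin elim by auto
    qed
    then show ?thesis unfolding \<Phi> by blast
  qed
qed

section \<open>The limit is a superposition of two free beams\<close>

lemma layer_integrable:
  assumes k: "averaging_kernel \<eta>" and G: "continuous_on UNIV G" and t: "t > 0"
  shows "integrable lborel (\<lambda>s. indicator {-\<epsilon>..\<epsilon>} s * (G (kernel_cdf \<eta> (s / \<epsilon>)) *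
     exp (- (((u1 + u2 * kernel_cdf \<eta> (s / \<epsilon>)) * t + s - x)\<^sup>2 / (2 * \<sigma>\<^sup>2 * t)))))"
proof -
  note [measurable] = kernel_cdf_borel[OF k] borel_measurable_continuous_onI[OF G]
  obtain M where GM: "\<And>y. \<bar>G (kernel_cdf \<eta> y)\<bar> \<le> M" using bounded_compose_kernel_cdf[OF k G] by blast
  have M0: "M \<ge> 0" using GM[of 0] by linarith
  have b: "\<bar>G (kernel_cdf \<eta> y)\<bar> * exp (- (w\<^sup>2 / (2 * \<sigma>\<^sup>2 * t))) \<le> M * 1" for y w
    using GM[of y] M0 t by (intro mult_mono) auto
  have "integrable lborel (\<lambda>s. indicator {-\<epsilon>..\<epsilon>} s * M)"
    by (intro integrable_mult_left integrable_real_indicator)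
      (auto simp: emeasure_compact_finite[unfolded infinity_ennreal_def])
  then show ?thesis
    by (rule Bochner_Integration.integrable_bound)
      (use b M0 in \<open>auto simp: indicator_def abs_mult\<close>)
qed

lemma has_iterated_limitI_linear:
  assumes "\<forall>\<^sub>F \<epsilon> in at_right 0. \<exists>l. (F \<epsilon> \<longlongrightarrow> l) (at_right 0) \<and> \<bar>l - L\<bar> \<le> B * \<epsilon>"
  shows "has_iterated_limit F L"
  unfolding has_iterated_limit_def
proof (intro exI conjI)
  let ?G = "\<lambda>\<epsilon>. SOME l. (F \<epsilon> \<longlongrightarrow> l) (at_right 0) \<and> \<bar>l - L\<bar> \<le> B * \<epsilon>"
  have ev: "\<forall>\<^sub>F \<epsilon> in at_right 0. (F \<epsilon> \<longlongrightarrow> ?G \<epsilon>) (at_right 0) \<and> \<bar>?G \<epsilon> - L\<bar> \<le> B * \<epsilon>"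
    using assms by eventually_elim (rule someI_ex)
  show "\<forall>\<^sub>F \<epsilon> in at_right 0. (F \<epsilon> \<longlongrightarrow> ?G \<epsilon>) (at_right 0)"
    using ev by eventually_elim simp
  have "((\<lambda>\<epsilon>. B * \<epsilon>) \<longlongrightarrow> B * 0) (at_right 0)" by (intro tendsto_intros)
  then have "((\<lambda>\<epsilon>. B * \<epsilon>) \<longlongrightarrow> 0) (at_right 0)" by simp
  moreover have "\<forall>\<^sub>F \<epsilon> in at_right 0. norm (?G \<epsilon> - L) \<le> B * \<epsilon>"
    using ev by eventually_elim simp
  ultimately have "((\<lambda>\<epsilon>. ?G \<epsilon> - L) \<longlongrightarrow> 0) (at_right 0)"
    by (rule Lim_null_comparison[rotated])
  then show "(?G \<longlongrightarrow> L) (at_right 0)" by (rule LIM_zero_cancel)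
qed

lemma has_iterated_limit_cong:
  assumes "\<And>\<epsilon> \<sigma>. \<epsilon> > 0 \<Longrightarrow> \<sigma> > 0 \<Longrightarrow> F \<epsilon> \<sigma> = F' \<epsilon> \<sigma>"
  shows "has_iterated_limit F l \<longleftrightarrow> has_iterated_limit F' l"
proof -
  have pos: "\<forall>\<^sub>F \<epsilon> in at_right (0::real). 0 < \<epsilon>" by (rule eventually_at_right_less)
  have "(F \<epsilon> \<longlongrightarrow> g) (at_right 0) \<longleftrightarrow> (F' \<epsilon> \<longlongrightarrow> g) (at_right 0)" if "\<epsilon> > 0" for \<epsilon> g
  proof (rule tendsto_cong)
    show "\<forall>\<^sub>F \<sigma> in at_right 0. F \<epsilon> \<sigma> = F' \<epsilon> \<sigma>"
      using pos by eventually_elim (rule assms[OF that])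
  qed
  then have "(\<forall>\<^sub>F \<epsilon> in at_right 0. (F \<epsilon> \<longlongrightarrow> G \<epsilon>) (at_right 0)) \<longleftrightarrow>
      (\<forall>\<^sub>F \<epsilon> in at_right 0. (F' \<epsilon> \<longlongrightarrow> G \<epsilon>) (at_right 0))" for G
    by (intro eventually_cong[OF pos]) simp
  then show ?thesis unfolding has_iterated_limit_def by (simp only:)
qed

lemma has_iterated_limit_unique:
  assumes "has_iterated_limit F l" "has_iterated_limit F l'"
  shows "l = l'"
proof -
  obtain G G' where G: "\<forall>\<^sub>F \<epsilon> in at_right 0. (F \<epsilon> \<longlongrightarrow> G \<epsilon>) (at_right 0)" "(G \<longlongrightarrow> l) (at_right 0)"
    and G': "\<forall>\<^sub>F \<epsilon> in at_right 0. (F \<epsilon> \<longlongrightarrow> G' \<epsilon>) (at_right 0)" "(G' \<longlongrightarrow> l') (at_right 0)"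
    using assms unfolding has_iterated_limit_def by blast
  have "\<forall>\<^sub>F \<epsilon> in at_right 0. G \<epsilon> = G' \<epsilon>"
    using G(1) G'(1) by eventually_elim (rule tendsto_unique[OF trivial_limit_at_right_real])
  with G(2) have "(G' \<longlongrightarrow> l) (at_right 0)" by (rule Lim_transform_eventually)
  then show ?thesis using G'(2) by (rule tendsto_unique[OF trivial_limit_at_right_real])
qed

lemma has_iterated_limit_divide:
  assumes "has_iterated_limit F a" "has_iterated_limit F' b" "b \<noteq> 0"
  shows "has_iterated_limit (\<lambda>\<epsilon> \<sigma>. F \<epsilon> \<sigma> / F' \<epsilon> \<sigma>) (a / b)"
proof -
  obtain G G' where G: "\<forall>\<^sub>F \<epsilon> in at_right 0. (F \<epsilon> \<longlongrightarrow> G \<epsilon>) (at_right 0)" "(G \<longlongrightarrow> a) (at_right 0)"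
    and G': "\<forall>\<^sub>F \<epsilon> in at_right 0. (F' \<epsilon> \<longlongrightarrow> G' \<epsilon>) (at_right 0)" "(G' \<longlongrightarrow> b) (at_right 0)"
    using assms unfolding has_iterated_limit_def by blast
  have "\<forall>\<^sub>F \<epsilon> in at_right 0. G' \<epsilon> \<noteq> 0" using G'(2) assms(3) by (rule tendsto_imp_eventually_ne)
  with G(1) G'(1) have "\<forall>\<^sub>F \<epsilon> in at_right 0. ((\<lambda>\<sigma>. F \<epsilon> \<sigma> / F' \<epsilon> \<sigma>) \<longlongrightarrow> G \<epsilon> / G' \<epsilon>) (at_right 0)"
    by eventually_elim (rule tendsto_divide)
  then show ?thesis
    unfolding has_iterated_limit_def using tendsto_divide[OF G(2) G'(2) assms(3)]
    by (intro exI[of _ "\<lambda>\<epsilon>. G \<epsilon> / G' \<epsilon>"] conjI)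
qed

text \<open>
  A quantity with the constant values \<open>c1\<close> and \<open>c2\<close> to the left and to the right of the origin at time
  \<open>0\<close>, whose two parts are then translated with the speeds \<open>v1\<close> and \<open>v2\<close> without interaction. On the
  fronts themselves, which are null sets, the moving part has the value \<open>0\<close>.
\<close>
definition two_beams :: "real \<Rightarrow> real \<Rightarrow> real \<Rightarrow> real \<Rightarrow> real \<times> real \<Rightarrow> real" where
  "two_beams c1 v1 c2 v2 z =
     (if snd z < v1 * fst z then c1 else 0) + (if v2 * fst z < snd z then c2 else 0)"

text \<open>
  On either side of the layer the smoothed velocity is constant, so the phase is a translation and the
  Gaussian concentrates at the starting point \<open>x - u1 t\<close> or \<open>x - (u1 + u2) t\<close>. That point counts
  exactly if it lies on its own side of the layer, which for small \<open>\<epsilon>\<close> means on its own side of the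
  origin. The density and the momentum are the instances of \<open>G\<close> needed later.
\<close>
lemma free_particle_limit:
  fixes G :: "real \<Rightarrow> real"
  assumes k: "averaging_kernel \<eta>" and G: "continuous_on UNIV G" and t: "t > 0" and u2: "u2 < 0"
    and reg: "regular_level \<eta> ((x - u1 * t) / (u2 * t))"
  shows "has_iterated_limit (\<lambda>\<epsilon> \<sigma>. 1 / (sqrt (2 * pi * t) * \<sigma>) * (LINT s|lborel. G (kernel_cdf \<eta> (s / \<epsilon>)) *
        exp (- (((u1 + u2 * kernel_cdf \<eta> (s / \<epsilon>)) * t + s - x)\<^sup>2 / (2 * \<sigma>\<^sup>2 * t)))))
      (two_beams (G 0) u1 (G 1) (u1 + u2) (t, x))"
proof -
  let ?H = "kernel_cdf \<eta>"
  let ?N = "\<lambda>\<sigma>. 1 / (sqrt (2 * pi * t) * \<sigma>)"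
  let ?E = "\<lambda>\<sigma> p. exp (- (p\<^sup>2 / (2 * \<sigma>\<^sup>2 * t)))"
  define L where "L = two_beams (G 0) u1 (G 1) (u1 + u2) (t, x)"
  define sl where "sl = x - u1 * t"
  define sr where "sr = x - (u1 + u2) * t"
  have "sl / (u2 * t) \<noteq> 0" "sl / (u2 * t) \<noteq> 1"
    using reg unfolding sl_def regular_level_def by blast+
  moreover have "sr = sl - u2 * t" by (simp add: sl_def sr_def algebra_simps)
  ultimately have ne: "sl \<noteq> 0" "sr \<noteq> 0" using t u2 by auto
  have Lval: "L = (if sl < 0 then G 0 else 0) + (if 0 < sr then G 1 else 0)"
    by (simp add: L_def two_beams_def sl_def sr_def)
  obtain B where B: "\<forall>\<^sub>F \<epsilon> in at_right 0. \<exists>l. ((\<lambda>\<sigma>. ?N \<sigma> * (LINT s|lborel. indicator {-\<epsilon>..\<epsilon>} s * (G (?H (s / \<epsilon>)) *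
        ?E \<sigma> ((u1 + u2 * ?H (s / \<epsilon>)) * t + s - x)))) \<longlongrightarrow> l) (at_right 0) \<and> \<bar>l\<bar> \<le> B * \<epsilon>"
    using layer_contribution[OF k G t u2 reg] by blast
  have small: "\<forall>\<^sub>F \<epsilon> in at_right 0. 0 < \<epsilon> \<and> \<epsilon> < \<bar>sl\<bar> \<and> \<epsilon> < \<bar>sr\<bar>"
    using ne by (auto simp: eventually_at_right_field intro!: exI[of _ "min \<bar>sl\<bar> \<bar>sr\<bar>"])
  have "\<forall>\<^sub>F \<epsilon> in at_right 0. \<exists>l. ((\<lambda>\<sigma>. ?N \<sigma> * (LINT s|lborel. G (?H (s / \<epsilon>)) *
        ?E \<sigma> ((u1 + u2 * ?H (s / \<epsilon>)) * t + s - x))) \<longlongrightarrow> l) (at_right 0) \<and> \<bar>l - L\<bar> \<le> B * \<epsilon>"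
    using B small
  proof eventually_elim
    case (elim \<epsilon>)
    then obtain l where l: "((\<lambda>\<sigma>. ?N \<sigma> * (LINT s|lborel. indicator {-\<epsilon>..\<epsilon>} s * (G (?H (s / \<epsilon>)) *
        ?E \<sigma> ((u1 + u2 * ?H (s / \<epsilon>)) * t + s - x)))) \<longlongrightarrow> l) (at_right 0)" "\<bar>l\<bar> \<le> B * \<epsilon>" by blast
    have e: "0 < \<epsilon>" "\<epsilon> < \<bar>sl\<bar>" "\<epsilon> < \<bar>sr\<bar>" using elim by auto
    have fr: "sl \<notin> frontier {..< -\<epsilon>}" "sr \<notin> frontier {\<epsilon><..}"
      using e by (auto simp: frontier_def interior_open)
    have left: "((\<lambda>\<sigma>. ?N \<sigma> * (LINT s|lborel. indicator {..< -\<epsilon>} s * (G 0 * ?E \<sigma> (s - sl))))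
        \<longlongrightarrow> (if sl \<in> {..< -\<epsilon>} then G 0 / \<bar>1\<bar> else 0)) (at_right 0)"
      by (rule gaussian_concentration[where M = "\<bar>G 0\<bar>" and c = 1])
        (use t fr in \<open>auto intro!: derivative_eq_intros\<close>)
    have right: "((\<lambda>\<sigma>. ?N \<sigma> * (LINT s|lborel. indicator {\<epsilon><..} s * (G 1 * ?E \<sigma> (s - sr))))
        \<longlongrightarrow> (if sr \<in> {\<epsilon><..} then G 1 / \<bar>1\<bar> else 0)) (at_right 0)"
      by (rule gaussian_concentration[where M = "\<bar>G 1\<bar>" and c = 1])
        (use t fr in \<open>auto intro!: derivative_eq_intros\<close>)
    have "((\<lambda>\<sigma>. ?N \<sigma> * (LINT s|lborel. indicator {..< -\<epsilon>} s * (G 0 * ?E \<sigma> (s - sl)))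
        + ?N \<sigma> * (LINT s|lborel. indicator {\<epsilon><..} s * (G 1 * ?E \<sigma> (s - sr)))
        + ?N \<sigma> * (LINT s|lborel. indicator {-\<epsilon>..\<epsilon>} s * (G (?H (s / \<epsilon>)) *
            ?E \<sigma> ((u1 + u2 * ?H (s / \<epsilon>)) * t + s - x)))) \<longlongrightarrow> L + l) (at_right 0)"
    proof -
      have "L = (if sl \<in> {..< -\<epsilon>} then G 0 / \<bar>1\<bar> else 0) + (if sr \<in> {\<epsilon><..} then G 1 / \<bar>1\<bar> else 0)"
        using e by (auto simp: Lval)
      then show ?thesis using tendsto_add[OF tendsto_add[OF left right] l(1)] by simp
    qed
    moreover have "\<forall>\<^sub>F \<sigma> in at_right 0. ?N \<sigma> * (LINT s|lborel. indicator {..< -\<epsilon>} s * (G 0 * ?E \<sigma> (s - sl)))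
        + ?N \<sigma> * (LINT s|lborel. indicator {\<epsilon><..} s * (G 1 * ?E \<sigma> (s - sr)))
        + ?N \<sigma> * (LINT s|lborel. indicator {-\<epsilon>..\<epsilon>} s * (G (?H (s / \<epsilon>)) *
            ?E \<sigma> ((u1 + u2 * ?H (s / \<epsilon>)) * t + s - x)))
        = ?N \<sigma> * (LINT s|lborel. G (?H (s / \<epsilon>)) * ?E \<sigma> ((u1 + u2 * ?H (s / \<epsilon>)) * t + s - x))"
      using eventually_at_right_less[of "0::real"]
    proof eventually_elim
      case (elim \<sigma>)
      have il: "integrable lborel (\<lambda>s. indicator {..< -\<epsilon>} s * (G 0 * ?E \<sigma> (s - sl)))"
        by (rule gaussian_concentration_integrable[where M = "\<bar>G 0\<bar>" and c = 1 and ?s0.0 = sl]) (use t elim in auto)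
      have ir: "integrable lborel (\<lambda>s. indicator {\<epsilon><..} s * (G 1 * ?E \<sigma> (s - sr)))"
        by (rule gaussian_concentration_integrable[where M = "\<bar>G 1\<bar>" and c = 1 and ?s0.0 = sr]) (use t elim in auto)
      have split: "G (?H (s / \<epsilon>)) * ?E \<sigma> ((u1 + u2 * ?H (s / \<epsilon>)) * t + s - x)
        = indicator {..< -\<epsilon>} s * (G 0 * ?E \<sigma> (s - sl)) + indicator {\<epsilon><..} s * (G 1 * ?E \<sigma> (s - sr))
        + indicator {-\<epsilon>..\<epsilon>} s * (G (?H (s / \<epsilon>)) * ?E \<sigma> ((u1 + u2 * ?H (s / \<epsilon>)) * t + s - x))" for s
      proof -
        consider "s < -\<epsilon>" | "\<epsilon> < s" | "s \<in> {-\<epsilon>..\<epsilon>}" by force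
        then show ?thesis
        proof cases
          case 1
          then have "?H (s / \<epsilon>) = 0" using e by (intro kernel_cdf_below[OF k]) (simp add: field_simps)
          then show ?thesis using 1 e by (simp add: sl_def algebra_simps)
        next
          case 2
          then have "?H (s / \<epsilon>) = 1" using e by (intro kernel_cdf_above[OF k]) (simp add: field_simps)
          then show ?thesis using 2 e by (simp add: sr_def algebra_simps)
        next
          case 3
          then show ?thesis by simp
        qed
      qed
      show ?case
        by (subst (2) split) (simp add: il ir layer_integrable[OF k G t] distrib_left)
    qed
    ultimately have "((\<lambda>\<sigma>. ?N \<sigma> * (LINT s|lborel. G (?H (s / \<epsilon>)) * ?E \<sigma> ((u1 + u2 * ?H (s / \<epsilon>)) * t + s - x)))
        \<longlongrightarrow> L + l) (at_right 0)"
      by (rule Lim_transform_eventually)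
    then show ?case using l(2) by (intro exI[of _ "L + l"]) simp
  qed
  then show ?thesis unfolding L_def by (rule has_iterated_limitI_linear)
qed

text \<open>
  Multiplying the numerator and the denominator of the velocity by the normalisation of the density
  makes it a quotient of two quantities with iterated limits. The limiting density is positive off the
  fronts because \<open>u2 < 0\<close> leaves no vacuum between the beams.
\<close>
lemma FP_limits_riemann:
  fixes f0 u0 :: "real \<Rightarrow> real"
  assumes f: "f1 > 0" "f1 + f2 > 0" and u2: "u2 < 0" and k: "averaging_kernel \<eta>" and t: "t > 0"
    and f0: "\<And>x. f0 x = f1 + f2 * heaviside x" and u0: "\<And>x. u0 x = u1 + u2 * heaviside x"
    and reg: "regular_level \<eta> ((x - u1 * t) / (u2 * t))"
  shows "has_iterated_limit (\<lambda>\<epsilon> \<sigma>. fp_density (averaged \<eta> \<epsilon> f0) (averaged \<eta> \<epsilon> u0) \<sigma> t x)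
           (two_beams f1 u1 (f1 + f2) (u1 + u2) (t, x))" (is ?dens)
    and "has_iterated_limit (\<lambda>\<epsilon> \<sigma>. fp_velocity (averaged \<eta> \<epsilon> f0) (averaged \<eta> \<epsilon> u0) \<sigma> t x)
           (two_beams (f1 * u1) u1 ((f1 + f2) * (u1 + u2)) (u1 + u2) (t, x) /
            two_beams f1 u1 (f1 + f2) (u1 + u2) (t, x))" (is ?vel)
proof -
  let ?H = "kernel_cdf \<eta>"
  note [measurable] = kernel_cdf_borel[OF k]
  define I where "I G \<epsilon> \<sigma> = (LINT s|lborel. G (?H (s / \<epsilon>)) *
        exp (- (((u1 + u2 * ?H (s / \<epsilon>)) * t + s - x)\<^sup>2 / (2 * \<sigma>\<^sup>2 * t))))" for G :: "real \<Rightarrow> real" and \<epsilon> \<sigma>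
  let ?f = "\<lambda>h. f1 + f2 * h" and ?m = "\<lambda>h. (u1 + u2 * h) * (f1 + f2 * h)"
  have av: "averaged \<eta> \<epsilon> f0 = (\<lambda>s. f1 + f2 * ?H (s / \<epsilon>))" "averaged \<eta> \<epsilon> u0 = (\<lambda>s. u1 + u2 * ?H (s / \<epsilon>))"
    if "\<epsilon> > 0" for \<epsilon>
  proof -
    have "f0 = (\<lambda>x. f1 + f2 * heaviside x)" "u0 = (\<lambda>x. u1 + u2 * heaviside x)" using f0 u0 by auto
    then show "averaged \<eta> \<epsilon> f0 = (\<lambda>s. f1 + f2 * ?H (s / \<epsilon>))" "averaged \<eta> \<epsilon> u0 = (\<lambda>s. u1 + u2 * ?H (s / \<epsilon>))"
      using averaged_step[OF k that] by auto
  qed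
  have If: "(LINT s|lebesgue. averaged \<eta> \<epsilon> f0 s * particle_weight (averaged \<eta> \<epsilon> u0) \<sigma> t x s) = I ?f \<epsilon> \<sigma>"
    and Im: "(LINT s|lebesgue. averaged \<eta> \<epsilon> u0 s * averaged \<eta> \<epsilon> f0 s * particle_weight (averaged \<eta> \<epsilon> u0) \<sigma> t x s)
      = I ?m \<epsilon> \<sigma>" if "\<epsilon> > 0" for \<epsilon> \<sigma>
    unfolding I_def av[OF that] particle_weight_def by (rule integral_completion; measurable)+
  have lf: "has_iterated_limit (\<lambda>\<epsilon> \<sigma>. 1 / (sqrt (2 * pi * t) * \<sigma>) * I ?f \<epsilon> \<sigma>)
      (two_beams f1 u1 (f1 + f2) (u1 + u2) (t, x))"
    using free_particle_limit[OF k _ t u2 reg, of ?f] unfolding I_def by (simp add: continuous_intros)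
  have lm: "has_iterated_limit (\<lambda>\<epsilon> \<sigma>. 1 / (sqrt (2 * pi * t) * \<sigma>) * I ?m \<epsilon> \<sigma>)
      (two_beams (f1 * u1) u1 ((f1 + f2) * (u1 + u2)) (u1 + u2) (t, x))"
    using free_particle_limit[OF k _ t u2 reg, of ?m] unfolding I_def
    by (simp add: continuous_intros mult.commute)
  show ?dens
    using lf by (rule has_iterated_limit_cong[THEN iffD1, rotated]) (simp add: fp_density_def If)
  have "u1 * t \<ge> (u1 + u2) * t" using t u2 by simp
  moreover have "x \<noteq> u1 * t" using reg by (auto simp: regular_level_def)
  ultimately have "two_beams f1 u1 (f1 + f2) (u1 + u2) (t, x) \<noteq> 0"
    using f by (auto simp: two_beams_def)
  from has_iterated_limit_divide[OF lm lf this]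
  show ?vel
    by (rule has_iterated_limit_cong[THEN iffD1, rotated]) (use t in \<open>simp add: fp_velocity_def If Im\<close>)
qed

section \<open>Weak conservation laws for beams\<close>

lemma borel_measurable_coordinates [measurable]:
  "(fst :: real \<times> real \<Rightarrow> real) \<in> borel_measurable borel"
  "(snd :: real \<times> real \<Rightarrow> real) \<in> borel_measurable borel"
  by (intro borel_measurable_continuous_onI continuous_intros)+

lemma test_function_deriv:
  assumes "test_function \<phi>"
  shows "(\<phi> has_derivative frechet_derivative \<phi> (at z)) (at z)"
    and "continuous_on UNIV (partial_t \<phi>)" and "continuous_on UNIV (partial_x \<phi>)"
proof -
  have "C_k (Suc 0) \<phi>" using assms unfolding test_function_def by blast
  then show "(\<phi> has_derivative frechet_derivative \<phi> (at z)) (at z)"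
    "continuous_on UNIV (partial_t \<phi>)" "continuous_on UNIV (partial_x \<phi>)"
    by (auto simp: frechet_derivative_works simp del: split_paired_All)
qed

lemma test_function_support:
  assumes "test_function \<phi>"
  obtains K where "compact K" "K \<subseteq> half_plane" "\<And>z. z \<notin> K \<Longrightarrow> \<phi> z = 0"
    "\<And>z. z \<notin> K \<Longrightarrow> partial_t \<phi> z = 0" "\<And>z. z \<notin> K \<Longrightarrow> partial_x \<phi> z = 0"
proof -
  obtain K where K: "compact K" "K \<subseteq> half_plane" "\<And>z. z \<notin> K \<Longrightarrow> \<phi> z = 0"
    using assms unfolding test_function_def by blast
  have "frechet_derivative \<phi> (at z) = (\<lambda>_. 0)" if "z \<notin> K" for z
  proof -
    have "open (- K)" using K(1) by (simp add: compact_imp_closed open_Compl)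
    then have "(\<phi> has_derivative (\<lambda>_. 0)) (at z)"
      by (rule has_derivative_transform_within_open[OF has_derivative_const]) (use K(3) that in auto)
    then show ?thesis by (rule frechet_derivative_at[symmetric])
  qed
  then show thesis using that[of K] K by (simp add: partial_t_def partial_x_def)
qed

lemma integrable_bounded_support:
  fixes g :: "real \<times> real \<Rightarrow> real"
  assumes "g \<in> borel_measurable borel" "compact K" "\<And>z. z \<notin> K \<Longrightarrow> g z = 0" "\<And>z. \<bar>g z\<bar> \<le> M"
  shows "integrable lborel g"
proof -
  have M0: "M \<ge> 0" using assms(4)[of 0] by linarith
  have "integrable lborel (\<lambda>z. indicator K z * M)"
    using assms(2) by (intro integrable_mult_left integrable_real_indicator)
      (auto simp: compact_imp_closed emeasure_compact_finite[unfolded infinity_ennreal_def] intro!: borel_closed)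
  then show ?thesis
    by (rule Bochner_Integration.integrable_bound)
       (use assms M0 in \<open>auto simp: indicator_def\<close>)
qed

text \<open>
  In the coordinate \<open>y = x - v t\<close> the translated profile is independent of time, while
  \<open>partial_t \<phi> + v partial_x \<phi>\<close> is the time derivative of \<open>\<phi>\<close> along the line \<open>x = y + v t\<close>. Its
  integral over each such line vanishes by compact support, and Fubini's theorem does the rest.
\<close>
lemma transport_integral:
  fixes r :: "real \<Rightarrow> real" and v :: real
  assumes r[measurable]: "r \<in> borel_measurable borel" and M: "\<And>y. \<bar>r y\<bar> \<le> M" and \<phi>: "test_function \<phi>"
  defines "\<psi> \<equiv> \<lambda>z. r (snd z - v * fst z) * (partial_t \<phi> z + v * partial_x \<phi> z)"
  shows "integrable lborel \<psi>" "(LINT z|lborel. \<psi> z) = 0"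
proof -
  obtain K where K: "compact K" "K \<subseteq> half_plane" "\<And>z. z \<notin> K \<Longrightarrow> \<phi> z = 0"
    "\<And>z. z \<notin> K \<Longrightarrow> partial_t \<phi> z = 0" "\<And>z. z \<notin> K \<Longrightarrow> partial_x \<phi> z = 0"
    using test_function_support[OF \<phi>] by metis
  define D where "D z = partial_t \<phi> z + v * partial_x \<phi> z" for z
  have Dcont: "continuous_on UNIV D"
    unfolding D_def using test_function_deriv[OF \<phi>] by (intro continuous_intros)
  note [measurable] = borel_measurable_continuous_onI[OF Dcont]
  have D0: "D z = 0" if "z \<notin> K" for z using K that by (simp add: D_def)
  have "compact (D ` K)" by (intro compact_continuous_image continuous_on_subset[OF Dcont] K) auto
  then obtain C where C: "\<And>z. z \<in> K \<Longrightarrow> \<bar>D z\<bar> \<le> C"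
    by (metis bounded_iff compact_imp_bounded image_eqI real_norm_def)
  have DC: "\<bar>D z\<bar> \<le> max 0 C" for z using C[of z] D0[of z] by (cases "z \<in> K") auto
  have M0: "M \<ge> 0" using M[of 0] by linarith
  have rD: "\<bar>r y * D z\<bar> \<le> M * max 0 C" for y z
    unfolding abs_mult using M DC M0 by (intro mult_mono) auto
  have \<psi>: "\<psi> = (\<lambda>z. r (snd z - v * fst z) * D z)" by (simp add: \<psi>_def D_def)
  have [measurable]: "\<psi> \<in> borel_measurable borel" unfolding \<psi> by measurable
  show int: "integrable lborel \<psi>"
    by (rule integrable_bounded_support[OF _ K(1)]) (use D0 rD in \<open>auto simp: \<psi>\<close>)
  let ?S = "\<lambda>z. (fst z, snd z + v * fst z)"
  define g where "g z = r (snd z) * D (?S z)" for z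
  have [measurable]: "g \<in> borel_measurable borel"
    unfolding g_def[abs_def] by measurable
  define T where "T z = (fst z, snd z - v * fst z)" for z :: "real \<times> real"
  have "continuous_on K T" unfolding T_def by (intro continuous_intros)
  then have "compact (T ` K)" using K(1) by (rule compact_continuous_image)
  then have int': "integrable lborel g"
  proof (rule integrable_bounded_support[rotated])
    fix z :: "real \<times> real"
    assume z: "z \<notin> T ` K"
    have "T (?S z) = z" by (simp add: T_def)
    then have "?S z \<notin> K" using z imageI[of "?S z" K T] by auto
    then show "g z = 0" by (simp add: g_def D0)
  qed (use rD in \<open>auto simp: g_def\<close>)
  have inner: "(LINT t|lborel. D (t, y + v * t)) = 0" for y
  proof -
    obtain b where b: "b > 0" "\<And>z. z \<in> K \<Longrightarrow> norm z < b"
      using compact_imp_bounded[OF K(1)] bounded_pos_less by blast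
    have out: "(t, w) \<notin> K" if "\<bar>t\<bar> \<ge> b" for t w
    proof
      assume "(t, w) \<in> K"
      then have "norm (t, w) < b" by (rule b(2))
      then show False using that norm_fst_le[of t w] by simp
    qed
    have der: "((\<lambda>t. \<phi> (t, y + v * t)) has_real_derivative D (t, y + v * t)) (at t)" for t
    proof -
      let ?d = "frechet_derivative \<phi> (at (t, y + v * t))"
      have d: "(\<phi> has_derivative ?d) (at (t, y + v * t))" by (rule test_function_deriv[OF \<phi>])
      have "((\<lambda>t. (t, y + v * t)) has_derivative (\<lambda>h. (h, v * h))) (at t)"
        by (auto intro!: derivative_eq_intros)
      from has_derivative_compose[OF this d]
      have "((\<lambda>t. \<phi> (t, y + v * t)) has_derivative (\<lambda>h. ?d (h, v * h))) (at t)" .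
      moreover have "?d (h, v * h) = D (t, y + v * t) * h" for h
      proof -
        have lin: "linear ?d" using has_derivative_linear[OF d] .
        have "?d (h, v * h) = ?d (h *\<^sub>R (1, 0) + (v * h) *\<^sub>R (0, 1))" by simp
        also have "\<dots> = h * ?d (1, 0) + v * h * ?d (0, 1)"
          by (simp only: linear_add[OF lin] linear_scale[OF lin] real_scaleR_def)
        finally show ?thesis by (simp add: D_def partial_t_def partial_x_def algebra_simps)
      qed
      ultimately show ?thesis by (simp add: has_field_derivative_def mult_commute_abs)
    qed
    have "(LINT t|lborel. indicator {-b..b} t *\<^sub>R D (t, y + v * t)) = \<phi> (b, y + v * b) - \<phi> (-b, y + v * (-b))"
    proof (rule integral_FTC_atLeastAtMost)
      show "continuous_on {-b..b} (\<lambda>t. D (t, y + v * t))"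
        by (rule continuous_on_compose2[OF Dcont]) (auto intro!: continuous_intros)
    qed (use b der in \<open>auto simp: has_real_derivative_iff_has_vector_derivative intro: has_vector_derivative_at_within\<close>)
    moreover have "(\<lambda>t. indicator {-b..b} t *\<^sub>R D (t, y + v * t)) = (\<lambda>t. D (t, y + v * t))"
    proof
      fix t
      show "indicator {-b..b} t *\<^sub>R D (t, y + v * t) = D (t, y + v * t)"
        using out[of t "y + v * t"] D0[of "(t, y + v * t)"] by (cases "t \<in> {-b..b}") auto
    qed
    ultimately show ?thesis using out b(1) K(3) by simp
  qed
  have shear: "(LINT x|lborel. \<psi> (t, x)) = (LINT y|lborel. g (t, y))" for t
    using lborel_integral_real_affine[of 1 "\<lambda>x. \<psi> (t, x)" "v * t"]
    by (simp add: \<psi> g_def add.commute)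
  have "(LINT z|lborel. \<psi> z) = (LINT t|lborel. LINT x|lborel. \<psi> (t, x))"
    using lborel_pair.integral_fst'[of \<psi>] int by (simp add: lborel_prod)
  also have "\<dots> = (LINT t|lborel. LINT y|lborel. g (t, y))"
    by (simp only: shear)
  also have "\<dots> = (LINT y|lborel. LINT t|lborel. g (t, y))"
    using lborel_pair.Fubini_integral[of "\<lambda>t y. g (t, y)"] int' by (simp add: lborel_prod)
  also have "\<dots> = (LINT y|lborel. r y * (LINT t|lborel. D (t, y + v * t)))"
    by (simp add: g_def)
  finally show "(LINT z|lborel. \<psi> z) = 0" using inner by simp
qed

lemma locally_integrable_two_beams: "locally_integrable (two_beams c1 v1 c2 v2)"
  unfolding locally_integrable_def set_integrable_def
proof (intro allI impI)
  fix K :: "(real \<times> real) set" assume K: "compact K \<and> K \<subseteq> half_plane"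
  have [measurable]: "K \<in> sets borel" using K by (auto simp: compact_imp_closed intro!: borel_closed)
  have [measurable]: "(\<lambda>z. indicator K z *\<^sub>R two_beams c1 v1 c2 v2 z) \<in> borel_measurable borel"
    unfolding two_beams_def[abs_def] by measurable
  have "integrable lborel (\<lambda>z. indicator K z *\<^sub>R two_beams c1 v1 c2 v2 z)"
    by (rule integrable_bounded_support[where K = K and M = "\<bar>c1\<bar> + \<bar>c2\<bar>"])
      (use K in \<open>auto simp: two_beams_def indicator_def\<close>)
  then show "integrable lebesgue (\<lambda>z. indicator K z *\<^sub>R two_beams c1 v1 c2 v2 z)"
    by (simp add: integrable_completion)
qed

lemma weak_conservation_law_two_beams:
  "weak_conservation_law (two_beams c1 v1 c2 v2) (two_beams (c1 * v1) v1 (c2 * v2) v2)"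
  unfolding weak_conservation_law_def
proof (intro conjI allI impI locally_integrable_two_beams)
  fix \<phi> assume \<phi>: "test_function \<phi>"
  define r1 where "r1 y = (if y < 0 then c1 else 0)" for y :: real
  define r2 where "r2 y = (if 0 < y then c2 else 0)" for y :: real
  have [measurable]: "r1 \<in> borel_measurable borel" "r2 \<in> borel_measurable borel"
    unfolding r1_def[abs_def] r2_def[abs_def] by measurable
  define b1 where "b1 z = r1 (snd z - v1 * fst z) * (partial_t \<phi> z + v1 * partial_x \<phi> z)" for z
  define b2 where "b2 z = r2 (snd z - v2 * fst z) * (partial_t \<phi> z + v2 * partial_x \<phi> z)" for z
  have i1: "integrable lborel b1" "integral\<^sup>L lborel b1 = 0"
    using transport_integral[of r1 "\<bar>c1\<bar>" \<phi> v1] \<phi> by (auto simp: r1_def b1_def[abs_def])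
  have i2: "integrable lborel b2" "integral\<^sup>L lborel b2 = 0"
    using transport_integral[of r2 "\<bar>c2\<bar>" \<phi> v2] \<phi> by (auto simp: r2_def b2_def[abs_def])
  obtain K where K: "K \<subseteq> half_plane" "\<And>z. z \<notin> K \<Longrightarrow> partial_t \<phi> z = 0" "\<And>z. z \<notin> K \<Longrightarrow> partial_x \<phi> z = 0"
    using test_function_support[OF \<phi>] by metis
  have "indicator half_plane z *\<^sub>R (two_beams c1 v1 c2 v2 z * partial_t \<phi> z
      + two_beams (c1 * v1) v1 (c2 * v2) v2 z * partial_x \<phi> z) = b1 z + b2 z" for z
  proof (cases "z \<in> half_plane")
    case True
    then show ?thesis by (simp add: two_beams_def b1_def b2_def r1_def r2_def algebra_simps)
  next
    case False
    then have "z \<notin> K" using K(1) by blast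
    then show ?thesis using K(2,3) by (simp add: b1_def b2_def)
  qed
  then have "(LINT z:half_plane|lebesgue. two_beams c1 v1 c2 v2 z * partial_t \<phi> z
      + two_beams (c1 * v1) v1 (c2 * v2) v2 z * partial_x \<phi> z) = (LINT z|lebesgue. b1 z + b2 z)"
    by (simp add: set_lebesgue_integral_def)
  also have "\<dots> = (LINT z|lborel. b1 z + b2 z)"
    using borel_measurable_integrable[OF i1(1)] borel_measurable_integrable[OF i2(1)]
    by (intro integral_completion) simp
  also have "\<dots> = 0" using i1 i2 by simp
  finally show "(LINT z:half_plane|lebesgue. two_beams c1 v1 c2 v2 z * partial_t \<phi> z
      + two_beams (c1 * v1) v1 (c2 * v2) v2 z * partial_x \<phi> z) = 0" .
qed

text \<open>
  Lebesgue measure is complete, so measurability passes between functions that agree almost everywhere,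
  and the integral of a non-measurable function is \<open>0\<close> by convention. An FP-solution is determined only
  up to null sets and comes without a measurability statement of its own.
\<close>
lemma lebesgue_integral_AE_cong:
  fixes f g :: "'a::euclidean_space \<Rightarrow> real"
  assumes ae: "AE z in lebesgue. f z = g z"
  shows "integrable lebesgue f \<longleftrightarrow> integrable lebesgue g" "integral\<^sup>L lebesgue f = integral\<^sup>L lebesgue g"
proof -
  have ae': "AE z in lebesgue. g z = f z" using ae by eventually_elim simp
  have meas: "f \<in> borel_measurable lebesgue \<longleftrightarrow> g \<in> borel_measurable lebesgue"
    using borel_measurable_AE[OF _ ae] borel_measurable_AE[OF _ ae'] by blast
  show iff: "integrable lebesgue f \<longleftrightarrow> integrable lebesgue g"
  proof
    assume f: "integrable lebesgue f"
    then have "f \<in> borel_measurable lebesgue" "g \<in> borel_measurable lebesgue" using meas by auto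
    then show "integrable lebesgue g" using f integrable_cong_AE[OF _ _ ae] by simp
  next
    assume g: "integrable lebesgue g"
    then have "f \<in> borel_measurable lebesgue" "g \<in> borel_measurable lebesgue" using meas by auto
    then show "integrable lebesgue f" using g integrable_cong_AE[OF _ _ ae] by simp
  qed
  show "integral\<^sup>L lebesgue f = integral\<^sup>L lebesgue g"
  proof (cases "f \<in> borel_measurable lebesgue")
    case True
    then show ?thesis using meas ae by (intro integral_cong_AE) auto
  next
    case False
    then have "\<not> integrable lebesgue f" by auto
    then show ?thesis using iff by (simp add: not_integrable_integral_eq)
  qed
qed

lemma weak_conservation_law_AE_cong:
  assumes law: "weak_conservation_law g h"
    and g: "AE z in lebesgue. z \<in> half_plane \<longrightarrow> g' z = g z"
    and h: "AE z in lebesgue. z \<in> half_plane \<longrightarrow> h' z = h z"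
  shows "weak_conservation_law g' h'"
proof -
  have loc: "locally_integrable a'" if "locally_integrable a" "AE z in lebesgue. z \<in> half_plane \<longrightarrow> a' z = a z"
    for a a' :: "real \<times> real \<Rightarrow> real"
    unfolding locally_integrable_def set_integrable_def
  proof (intro allI impI)
    fix K :: "(real \<times> real) set" assume K: "compact K \<and> K \<subseteq> half_plane"
    have ae: "AE z in lebesgue. indicator K z *\<^sub>R a z = indicator K z *\<^sub>R a' z"
      using that(2) by eventually_elim (use K in \<open>auto simp: indicator_def\<close>)
    have "integrable lebesgue (\<lambda>z. indicator K z *\<^sub>R a z)"
      using that(1) K by (simp add: locally_integrable_def set_integrable_def)
    then show "integrable lebesgue (\<lambda>z. indicator K z *\<^sub>R a' z)"
      by (rule lebesgue_integral_AE_cong(1)[OF ae, THEN iffD1])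
  qed
  have "(LINT z:half_plane|lebesgue. g' z * partial_t \<phi> z + h' z * partial_x \<phi> z) =
      (LINT z:half_plane|lebesgue. g z * partial_t \<phi> z + h z * partial_x \<phi> z)" for \<phi>
    unfolding set_lebesgue_integral_def
  proof (rule lebesgue_integral_AE_cong(2))
    show "AE z in lebesgue. indicator half_plane z *\<^sub>R (g' z * partial_t \<phi> z + h' z * partial_x \<phi> z) =
      indicator half_plane z *\<^sub>R (g z * partial_t \<phi> z + h z * partial_x \<phi> z)"
      using g h by eventually_elim (auto simp: indicator_def)
  qed
  then show ?thesis
    using law loc[OF _ g] loc[OF _ h] unfolding weak_conservation_law_def by simp
qed

section \<open>The Riemann problem\<close>

text \<open>
  The decomposition of the second moment of a mixture of two velocities into squared mean and variance.
\<close>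
lemma mixture_second_moment:
  fixes a b v w :: real
  assumes "a + b \<noteq> 0"
  shows "(a + b) * ((a * v + b * w) / (a + b))\<^sup>2 + a * b * (w - v)\<^sup>2 / (a + b) = a * v * v + b * w * w"
proof -
  have "(a + b) * ((a * v + b * w) / (a + b))\<^sup>2 = (a * v + b * w)\<^sup>2 / (a + b)"
    using assms by (simp add: power2_eq_square)
  then have "(a + b) * ((a * v + b * w) / (a + b))\<^sup>2 + a * b * (w - v)\<^sup>2 / (a + b)
      = ((a * v + b * w)\<^sup>2 + a * b * (w - v)\<^sup>2) / (a + b)"
    by (simp add: add_divide_distrib)
  also have "(a * v + b * w)\<^sup>2 + a * b * (w - v)\<^sup>2 = (a * v * v + b * w * w) * (a + b)"
    by (simp add: power2_eq_square algebra_simps)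
  also have "\<dots> / (a + b) = a * v * v + b * w * w" using assms by simp
  finally show ?thesis .
qed

lemma AE_half_plane_FP_limits:
  fixes f0 u0 :: "real \<Rightarrow> real"
  assumes f: "f1 > 0" "f1 + f2 > 0" and u2: "u2 < 0" and k: "averaging_kernel \<eta>"
    and f0: "\<And>x. f0 x = f1 + f2 * heaviside x" and u0: "\<And>x. u0 x = u1 + u2 * heaviside x"
  shows "AE z in lebesgue. 0 < fst z \<longrightarrow> snd z \<noteq> u1 * fst z \<and> snd z \<noteq> (u1 + u2) * fst z \<and>
     has_iterated_limit (\<lambda>\<epsilon> \<sigma>. fp_density (averaged \<eta> \<epsilon> f0) (averaged \<eta> \<epsilon> u0) \<sigma> (fst z) (snd z))
       (two_beams f1 u1 (f1 + f2) (u1 + u2) z) \<and>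
     has_iterated_limit (\<lambda>\<epsilon> \<sigma>. fp_velocity (averaged \<eta> \<epsilon> f0) (averaged \<eta> \<epsilon> u0) \<sigma> (fst z) (snd z))
       (two_beams (f1 * u1) u1 ((f1 + f2) * (u1 + u2)) (u1 + u2) z /
        two_beams f1 u1 (f1 + f2) (u1 + u2) z)"
  using AE_regular_level[OF k less_imp_neq[OF u2], of u1]
proof eventually_elim
  case (elim z)
  obtain t x where z: "z = (t, x)" by (cases z)
  show ?case
  proof (intro impI)
    assume "0 < fst z"
    then have t: "t > 0" and reg: "regular_level \<eta> ((x - u1 * t) / (u2 * t))" using elim z by auto
    have "(x - u1 * t) / (u2 * t) \<noteq> 0" "(x - u1 * t) / (u2 * t) \<noteq> 1"
      using reg unfolding regular_level_def by blast+
    then have "x \<noteq> u1 * t" "x \<noteq> (u1 + u2) * t" using t u2 by (auto simp: algebra_simps)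
    then show "snd z \<noteq> u1 * fst z \<and> snd z \<noteq> (u1 + u2) * fst z \<and>
     has_iterated_limit (\<lambda>\<epsilon> \<sigma>. fp_density (averaged \<eta> \<epsilon> f0) (averaged \<eta> \<epsilon> u0) \<sigma> (fst z) (snd z))
       (two_beams f1 u1 (f1 + f2) (u1 + u2) z) \<and>
     has_iterated_limit (\<lambda>\<epsilon> \<sigma>. fp_velocity (averaged \<eta> \<epsilon> f0) (averaged \<eta> \<epsilon> u0) \<sigma> (fst z) (snd z))
       (two_beams (f1 * u1) u1 ((f1 + f2) * (u1 + u2)) (u1 + u2) z /
        two_beams f1 u1 (f1 + f2) (u1 + u2) z)"
      using FP_limits_riemann[OF f u2 k t f0 u0 reg] by (simp add: z)
  qed
qed

text \<open>
  Where a single beam is present its momentum flux is density times squared velocity. Where both are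
  present the velocity is their mean, and the missing variance is the pressure: the difference of the
  two Heaviside functions is the indicator of the overlap.
\<close>
lemma two_beams_equation_of_state:
  assumes f: "f1 > 0" "f1 + f2 > 0" and u2: "u2 < 0"
    and z: "0 < fst z" "snd z \<noteq> u1 * fst z" "snd z \<noteq> (u1 + u2) * fst z"
  defines "\<rho> \<equiv> two_beams f1 u1 (f1 + f2) (u1 + u2) z"
    and "j \<equiv> two_beams (f1 * u1) u1 ((f1 + f2) * (u1 + u2)) (u1 + u2) z"
  shows "\<rho> * (j / \<rho>) = j"
    and "\<rho> * (j / \<rho>)\<^sup>2 + f1 * (f1 + f2) * u2\<^sup>2 / (2 * f1 + f2) *
           (heaviside (snd z - (u1 + u2) * fst z) - heaviside (snd z - u1 * fst z))
       = two_beams (f1 * u1 * u1) u1 ((f1 + f2) * (u1 + u2) * (u1 + u2)) (u1 + u2) z"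
proof -
  have order: "(u1 + u2) * fst z < u1 * fst z" using z(1) u2 by simp
  have "\<rho> > 0" using f order z(2) by (auto simp: \<rho>_def two_beams_def)
  then show "\<rho> * (j / \<rho>) = j" by simp
  consider "snd z < (u1 + u2) * fst z" | "(u1 + u2) * fst z < snd z" "snd z < u1 * fst z"
    | "u1 * fst z < snd z" using z(2,3) by linarith
  then show "\<rho> * (j / \<rho>)\<^sup>2 + f1 * (f1 + f2) * u2\<^sup>2 / (2 * f1 + f2) *
           (heaviside (snd z - (u1 + u2) * fst z) - heaviside (snd z - u1 * fst z))
       = two_beams (f1 * u1 * u1) u1 ((f1 + f2) * (u1 + u2) * (u1 + u2)) (u1 + u2) z"
  proof cases
    case 1
    then have "snd z < u1 * fst z" using order by linarith
    then show ?thesis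
      using 1 f by (simp add: \<rho>_def j_def two_beams_def heaviside_def power2_eq_square)
  next
    case 2
    have "f1 + (f1 + f2) \<noteq> 0" using f by linarith
    from mixture_second_moment[OF this, of u1 "u1 + u2"] show ?thesis
      using 2 by (simp add: \<rho>_def j_def two_beams_def heaviside_def add.assoc[symmetric])
  next
    case 3
    then have "(u1 + u2) * fst z < snd z" using order by linarith
    then show ?thesis
      using 3 f by (simp add: \<rho>_def j_def two_beams_def heaviside_def power2_eq_square)
  qed
qed

theorem theorem3:
  fixes f1 f2 u1 u2 :: real and \<eta> f0 u0 :: "real \<Rightarrow> real" and p :: "real \<times> real \<Rightarrow> real"
  assumes "f1 > 0" and "f1 + f2 > 0" and "u2 < 0"
    and "averaging_kernel \<eta>"
    and "\<And>x. f0 x = f1 + f2 * heaviside x"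
    and "\<And>x. u0 x = u1 + u2 * heaviside x"
    and "\<And>t x. p (t, x) =
           f1 * (f1 + f2) * u2\<^sup>2 / (2 * f1 + f2) *
           (heaviside (x - (u1 + u2) * t) - heaviside (x - u1 * t))"
  shows "(\<exists>f u. FP_solution \<eta> f0 u0 f u) \<and>
         (\<forall>f u. FP_solution \<eta> f0 u0 f u \<longrightarrow> weak_gas_dynamics f u p)"
proof -
  let ?\<rho> = "two_beams f1 u1 (f1 + f2) (u1 + u2)"
  let ?j = "two_beams (f1 * u1) u1 ((f1 + f2) * (u1 + u2)) (u1 + u2)"
  let ?q = "two_beams (f1 * u1 * u1) u1 ((f1 + f2) * (u1 + u2) * (u1 + u2)) (u1 + u2)"
  note limits = AE_half_plane_FP_limits[OF assms(1-6)]
  note state = two_beams_equation_of_state[OF assms(1-3)]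
  have "FP_solution \<eta> f0 u0 ?\<rho> (\<lambda>z. ?j z / ?\<rho> z)"
    unfolding FP_solution_def using limits by eventually_elim auto
  moreover have "weak_gas_dynamics f u p" if FP: "FP_solution \<eta> f0 u0 f u" for f u
  proof -
    have "AE z in lebesgue. z \<in> half_plane \<longrightarrow> f z = ?\<rho> z \<and> f z * u z = ?j z \<and> f z * (u z)\<^sup>2 + p z = ?q z"
      using limits FP[unfolded FP_solution_def]
    proof eventually_elim
      case (elim z)
      show ?case
      proof
        assume "z \<in> half_plane"
        then have t: "0 < fst z" by (auto simp: half_plane_def)
        have ne: "snd z \<noteq> u1 * fst z" "snd z \<noteq> (u1 + u2) * fst z" using elim(1) t by auto
        have "f z = ?\<rho> z" "u z = ?j z / ?\<rho> z"
          using elim t by (auto simp: case_prod_beta intro: has_iterated_limit_unique)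
        moreover have "p z = f1 * (f1 + f2) * u2\<^sup>2 / (2 * f1 + f2) *
           (heaviside (snd z - (u1 + u2) * fst z) - heaviside (snd z - u1 * fst z))"
          using assms(7)[of "fst z" "snd z"] by simp
        ultimately show "f z = ?\<rho> z \<and> f z * u z = ?j z \<and> f z * (u z)\<^sup>2 + p z = ?q z"
          using state[OF t ne] by simp
      qed
    qed
    then have density: "AE z in lebesgue. z \<in> half_plane \<longrightarrow> f z = ?\<rho> z"
      and momentum: "AE z in lebesgue. z \<in> half_plane \<longrightarrow> f z * u z = ?j z"
      and flux: "AE z in lebesgue. z \<in> half_plane \<longrightarrow> f z * (u z)\<^sup>2 + p z = ?q z"
      by (eventually_elim, blast)+
    show ?thesis
      unfolding weak_gas_dynamics_def
      using weak_conservation_law_AE_cong[OF weak_conservation_law_two_beams density momentum]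
        weak_conservation_law_AE_cong[OF weak_conservation_law_two_beams momentum flux] by (rule conjI)
  qed
  ultimately show ?thesis by blast
qed

end
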